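(* Let $p$ be a prime, let $q$ be an odd prime with $\gcd(p,q)=1$, let $\nu,k,s$ be positive integers, and let $A=(\mathbb{Z}_{q^k})^s$. Let $r_I$ be the number of $p^\nu$-cyclotomic classes of $A$ of type $I$ and $2r_{II}$ the number of those of type $II$. If $\mathrm{ord}_q(p^\nu)$ is even, then $$r_I=1+\sum_{i=1}^{k}\frac{q^{is}-q^{(i-1)s}}{\mathrm{ord}_{q^i}(p^\nu)}\quad\text{and}\quad r_{II}=0.$$ If $\mathrm{ord}_q(p^\nu)$ is odd, then $$r_I=1\quad\text{and}\quad r_{II}=\sum_{i=1}^{k}\frac{q^{is}-q^{(i-1)s}}{2\,\mathrm{ord}_{q^i}(p^\nu)}.$$ In both cases the number of Euclidean complementary dual abelian codes in $\mathbb{F}_{p^\nu}[(\mathbb{Z}_{q^k})^s]$ is $2^{r_I+r_{II}}$.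
   Context: For a finite abelian group $G$ (written additively), an abelian code in $\mathbb{F}_{p^\nu}[G]$ is an ideal of this group algebra. For $u=\sum_g u_gY^g$, $v=\sum_g v_gY^g$, $\langle u,v\rangle_{\rm E}=\sum_g u_gv_g$; $C^{\perp_{\rm E}}=\{v : \langle c,v\rangle_{\rm E}=0\ \forall c\in C\}$; $C$ is Euclidean complementary dual if $C\cap C^{\perp_{\rm E}}=\{0\}$. For $a\in A$, $S_{p^\nu}(a)=\{p^{\nu i}\cdot a : i\ge 0\}$ is the $p^\nu$-cyclotomic class of $a$ (these classes partition $A$); it is of type $I$ if $S_{p^\nu}(a)=S_{p^\nu}(-a)$ and of type $II$ otherwise; type $II$ classes come in pairs $S_{p^\nu}(a)\ne S_{p^\nu}(-a)$. $\mathrm{ord}_m(x)$ denotes the multiplicative order of $x$ modulo $m$. *)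

theory Defs
  imports "HOL-Algebra.Product_Groups" "HOL-Number_Theory.Number_Theory"
begin

text \<open>
  HOL-Algebra groups are written multiplicatively, so in an abelian group \<open>G\<close> the additive
  expressions \<open>g - h\<close>, \<open>-a\<close> and \<open>n \<cdot> a\<close> appear below as \<open>inv h \<otimes> g\<close>, \<open>inv a\<close> and \<open>a [^] n\<close>.
  An element \<open>\<Sum>g. u\<^sub>g Y\<^sup>g\<close> of the group algebra is its coefficient function
  \<open>u \<in> carrier G \<rightarrow>\<^sub>E carrier F\<close>; the group is meant to be finite, as \<open>finsum\<close> over an infinite
  set is a dummy value.
\<close>

definition group_algebra ::
    "('f, 'm) ring_scheme \<Rightarrow> ('g, 'n) monoid_scheme \<Rightarrow> ('g \<Rightarrow> 'f) ring" where
  "group_algebra F G =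
     \<lparr>carrier = carrier G \<rightarrow>\<^sub>E carrier F,
      monoid.mult = (\<lambda>u v. \<lambda>g\<in>carrier G. \<Oplus>\<^bsub>F\<^esub>h\<in>carrier G. u h \<otimes>\<^bsub>F\<^esub> v (inv\<^bsub>G\<^esub> h \<otimes>\<^bsub>G\<^esub> g)),
      monoid.one = (\<lambda>g\<in>carrier G. if g = \<one>\<^bsub>G\<^esub> then \<one>\<^bsub>F\<^esub> else \<zero>\<^bsub>F\<^esub>),
      ring.zero = (\<lambda>g\<in>carrier G. \<zero>\<^bsub>F\<^esub>),
      ring.add = (\<lambda>u v. \<lambda>g\<in>carrier G. u g \<oplus>\<^bsub>F\<^esub> v g)\<rparr>"

definition abelian_code ::
    "('f, 'm) ring_scheme \<Rightarrow> ('g, 'n) monoid_scheme \<Rightarrow> ('g \<Rightarrow> 'f) set \<Rightarrow> bool" where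
  "abelian_code F G C \<longleftrightarrow> ideal C (group_algebra F G)"

definition euclidean_inner ::
    "('f, 'm) ring_scheme \<Rightarrow> ('g, 'n) monoid_scheme \<Rightarrow> ('g \<Rightarrow> 'f) \<Rightarrow> ('g \<Rightarrow> 'f) \<Rightarrow> 'f" where
  "euclidean_inner F G u v = (\<Oplus>\<^bsub>F\<^esub>g\<in>carrier G. u g \<otimes>\<^bsub>F\<^esub> v g)"

definition euclidean_dual ::
    "('f, 'm) ring_scheme \<Rightarrow> ('g, 'n) monoid_scheme \<Rightarrow> ('g \<Rightarrow> 'f) set \<Rightarrow> ('g \<Rightarrow> 'f) set" where
  "euclidean_dual F G C =
     {v \<in> carrier (group_algebra F G). \<forall>c\<in>C. euclidean_inner F G c v = \<zero>\<^bsub>F\<^esub>}"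

definition euclidean_complementary_dual ::
    "('f, 'm) ring_scheme \<Rightarrow> ('g, 'n) monoid_scheme \<Rightarrow> ('g \<Rightarrow> 'f) set \<Rightarrow> bool" where
  "euclidean_complementary_dual F G C \<longleftrightarrow>
     C \<inter> euclidean_dual F G C = {\<zero>\<^bsub>group_algebra F G\<^esub>}"

definition cyclotomic_class :: "('g, 'n) monoid_scheme \<Rightarrow> nat \<Rightarrow> 'g \<Rightarrow> 'g set" where
  "cyclotomic_class G m a = {a [^]\<^bsub>G\<^esub> (m ^ i) | i :: nat. True}"

definition type_I_classes :: "('g, 'n) monoid_scheme \<Rightarrow> nat \<Rightarrow> 'g set set" where
  "type_I_classes G m =
     {cyclotomic_class G m a | a. a \<in> carrier G \<and>
        cyclotomic_class G m a = cyclotomic_class G m (inv\<^bsub>G\<^esub> a)}"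

definition type_II_classes :: "('g, 'n) monoid_scheme \<Rightarrow> nat \<Rightarrow> 'g set set" where
  "type_II_classes G m =
     {cyclotomic_class G m a | a. a \<in> carrier G \<and>
        cyclotomic_class G m a \<noteq> cyclotomic_class G m (inv\<^bsub>G\<^esub> a)}"

definition homocyclic_group :: "nat \<Rightarrow> nat \<Rightarrow> (nat \<Rightarrow> int) monoid" where
  "homocyclic_group n s = product_group {..<s} (\<lambda>_. integer_mod_group n)"

text \<open>
  The type II classes of a finite group come in pairs, so their number is of the form \<open>2 * r\<close>.
\<close>


lemma involution_even_card:
  assumes "finite X" "\<And>x. x \<in> X \<Longrightarrow> f x \<in> X \<and> f (f x) = x \<and> f x \<noteq> x"
  shows "even (card X)"
  using assms
proof (induction X rule: finite_psubset_induct)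
  case (psubset X)
  show ?case
  proof (cases "X = {}")
    case False
    then obtain x where x: "x \<in> X" by auto
    let ?Y = "X - {x, f x}"
    have "even (card ?Y)"
    proof (rule psubset.IH)
      show "?Y \<subset> X" using x by auto
      show "f y \<in> ?Y \<and> f (f y) = y \<and> f y \<noteq> y" if "y \<in> ?Y" for y
        using psubset.prems[of y] psubset.prems[of x] that x by (metis DiffD1 DiffD2 DiffI insert_iff singletonD)
    qed
    moreover have "card X = card ?Y + 2"
    proof -
      have "{x, f x} \<subseteq> X" "card {x, f x} = 2" using psubset.prems[OF x] x by auto
      then show ?thesis using psubset.hyps
        by (metis add.commute card_Diff_subset card_mono finite.emptyI finite.insertI le_add_diff_inverse)
    qed
    ultimately show ?thesis by simp
  qed simp
qed

lemma (in group) inv_image_cyclotomic_class: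
  assumes "a \<in> carrier G"
  shows "m_inv G ` cyclotomic_class G m a = cyclotomic_class G m (inv a)"
proof -
  have "inv (a [^] n) = inv a [^] n" for n :: nat
    using assms by (simp add: nat_pow_inv)
  then show ?thesis by (auto simp: cyclotomic_class_def image_iff; metis)
qed

lemma (in group) even_card_type_II_classes:
  assumes "finite (carrier G)"
  shows "even (card (type_II_classes G m))"
proof (rule involution_even_card)
  have "type_II_classes G m \<subseteq> cyclotomic_class G m ` carrier G"
    by (auto simp: type_II_classes_def)
  then show "finite (type_II_classes G m)"
    using assms finite_subset by blast
next
  fix X assume "X \<in> type_II_classes G m"
  then obtain a where a: "a \<in> carrier G" "X = cyclotomic_class G m a"
      "cyclotomic_class G m a \<noteq> cyclotomic_class G m (inv a)"
    by (auto simp: type_II_classes_def)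
  then have i: "m_inv G ` X = cyclotomic_class G m (inv a)"
    by (simp add: inv_image_cyclotomic_class)
  moreover have "m_inv G ` (m_inv G ` X) = X"
    unfolding i using a by (simp add: inv_image_cyclotomic_class)
  moreover have "cyclotomic_class G m (inv a) \<in> type_II_classes G m"
    unfolding type_II_classes_def using a by (auto intro!: exI[of _ "inv a"])
  ultimately show "m_inv G ` X \<in> type_II_classes G m \<and> m_inv G ` (m_inv G ` X) = X
      \<and> m_inv G ` X \<noteq> X"
    using a by auto
qed

text \<open>
  The locale \<open>ideal\<close> presupposes a ring; for finite \<open>G\<close> the group algebra is one.
\<close>

lemma (in abelian_monoid) finsum_exchange:
  assumes "finite X" "finite Y" "\<And>x y. x \<in> X \<Longrightarrow> y \<in> Y \<Longrightarrow> f x y \<in> carrier G"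
  shows "(\<Oplus>x\<in>X. \<Oplus>y\<in>Y. f x y) = (\<Oplus>y\<in>Y. \<Oplus>x\<in>X. f x y)"
  using assms(1,3)
proof (induction X rule: finite_induct)
  case empty
  then show ?case by (simp add: finsum_zero)
next
  case (insert a X)
  have "(\<Oplus>x\<in>insert a X. \<Oplus>y\<in>Y. f x y) = (\<Oplus>y\<in>Y. f a y) \<oplus> (\<Oplus>x\<in>X. \<Oplus>y\<in>Y. f x y)"
    using insert by (intro finsum_insert) (auto intro!: finsum_closed)
  also have "\<dots> = (\<Oplus>y\<in>Y. f a y) \<oplus> (\<Oplus>y\<in>Y. \<Oplus>x\<in>X. f x y)"
    using insert by auto
  also have "\<dots> = (\<Oplus>y\<in>Y. f a y \<oplus> (\<Oplus>x\<in>X. f x y))"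
    using insert by (intro finsum_addf[symmetric]) (auto intro!: finsum_closed)
  also have "\<dots> = (\<Oplus>y\<in>Y. \<Oplus>x\<in>insert a X. f x y)"
    using insert by (intro finsum_cong' refl) (auto intro!: finsum_closed finsum_insert[symmetric])
  finally show ?case .
qed

lemma ring_group_algebra:
  fixes F (structure) and G (structure)
  assumes "ring F" "group G" and fin: "finite (carrier G)"
  shows "ring (group_algebra F G)"
proof -
  interpret R: ring F by fact
  interpret group G by fact
  note defs = group_algebra_def
  have ap: "u g \<in> carrier F" if "u \<in> carrier (group_algebra F G)" "g \<in> carrier G" for u g
    using that unfolding defs by (simp add: PiE_mem[of u "carrier G" "\<lambda>_. carrier F"])
  have eqI: "u = v" if "u \<in> carrier (group_algebra F G)" "v \<in> carrier (group_algebra F G)"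
    "\<And>g. g \<in> carrier G \<Longrightarrow> u g = v g" for u v
    using that by (auto simp: defs intro: PiE_ext)
  have mult_cl: "u \<otimes>\<^bsub>group_algebra F G\<^esub> v \<in> carrier (group_algebra F G)"
    if "u \<in> carrier (group_algebra F G)" "v \<in> carrier (group_algebra F G)" for u v
    unfolding defs using that[THEN ap] by (auto intro!: R.finsum_closed)
  have add_cl: "u \<oplus>\<^bsub>group_algebra F G\<^esub> v \<in> carrier (group_algebra F G)"
    if "u \<in> carrier (group_algebra F G)" "v \<in> carrier (group_algebra F G)" for u v
    unfolding defs using that[THEN ap] by auto
  have one_cl: "\<one>\<^bsub>group_algebra F G\<^esub> \<in> carrier (group_algebra F G)"
    by (auto simp: defs)
  have mult: "(u \<otimes>\<^bsub>group_algebra F G\<^esub> v) g = (\<Oplus>\<^bsub>F\<^esub>h\<in>carrier G. u h \<otimes>\<^bsub>F\<^esub> v (inv\<^bsub>G\<^esub> h \<otimes>\<^bsub>G\<^esub> g))"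
    if "g \<in> carrier G" for u v g using that by (simp add: defs)
  have add: "(u \<oplus>\<^bsub>group_algebra F G\<^esub> v) g = u g \<oplus>\<^bsub>F\<^esub> v g" if "g \<in> carrier G" for u v g
    using that by (simp add: defs)
  have one: "\<one>\<^bsub>group_algebra F G\<^esub> g = (if g = \<one>\<^bsub>G\<^esub> then \<one>\<^bsub>F\<^esub> else \<zero>\<^bsub>F\<^esub>)"
    if "g \<in> carrier G" for g using that by (simp add: defs)
  show ?thesis
  proof (rule ringI)
    show "abelian_group (group_algebra F G)"
    proof (rule abelian_groupI)
      show "\<zero>\<^bsub>group_algebra F G\<^esub> \<in> carrier (group_algebra F G)" by (simp add: defs)
    next
      fix u v w assume u: "u \<in> carrier (group_algebra F G)" and v: "v \<in> carrier (group_algebra F G)"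
        and w: "w \<in> carrier (group_algebra F G)"
      show "u \<oplus>\<^bsub>group_algebra F G\<^esub> v \<oplus>\<^bsub>group_algebra F G\<^esub> w
          = u \<oplus>\<^bsub>group_algebra F G\<^esub> (v \<oplus>\<^bsub>group_algebra F G\<^esub> w)"
        by (intro eqI add_cl u v w) (simp add: add ap[OF u] ap[OF v] ap[OF w] R.a_assoc)
      show "u \<oplus>\<^bsub>group_algebra F G\<^esub> v = v \<oplus>\<^bsub>group_algebra F G\<^esub> u"
        by (intro eqI add_cl u v w) (simp add: add ap[OF u] ap[OF v] R.a_comm)
      show "u \<oplus>\<^bsub>group_algebra F G\<^esub> v \<in> carrier (group_algebra F G)"
        by (intro add_cl u v)
      show "\<zero>\<^bsub>group_algebra F G\<^esub> \<oplus>\<^bsub>group_algebra F G\<^esub> u = u"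
        by (intro eqI add_cl u) (use ap[OF u] in \<open>simp_all add: defs\<close>)
      show "\<exists>v\<in>carrier (group_algebra F G). v \<oplus>\<^bsub>group_algebra F G\<^esub> u = \<zero>\<^bsub>group_algebra F G\<^esub>"
        by (rule bexI[of _ "\<lambda>g\<in>carrier G. \<ominus>\<^bsub>F\<^esub> u g"])
           (use ap[OF u] in \<open>simp_all add: defs R.l_neg cong: restrict_cong\<close>)
    qed
  next
    show "monoid (group_algebra F G)"
    proof (rule monoidI)
      fix u v w
      assume u: "u \<in> carrier (group_algebra F G)" and v: "v \<in> carrier (group_algebra F G)"
        and w: "w \<in> carrier (group_algebra F G)"
      show "u \<otimes>\<^bsub>group_algebra F G\<^esub> v \<otimes>\<^bsub>group_algebra F G\<^esub> w
          = u \<otimes>\<^bsub>group_algebra F G\<^esub> (v \<otimes>\<^bsub>group_algebra F G\<^esub> w)"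
      proof (intro eqI mult_cl u v w)
        fix g assume g: "g \<in> carrier G"
        let ?c = "carrier G"
        have "(u \<otimes>\<^bsub>group_algebra F G\<^esub> v \<otimes>\<^bsub>group_algebra F G\<^esub> w) g
          = (\<Oplus>\<^bsub>F\<^esub>h\<in>?c. (\<Oplus>\<^bsub>F\<^esub>l\<in>?c. u l \<otimes>\<^bsub>F\<^esub> v (inv\<^bsub>G\<^esub> l \<otimes>\<^bsub>G\<^esub> h)) \<otimes>\<^bsub>F\<^esub> w (inv\<^bsub>G\<^esub> h \<otimes>\<^bsub>G\<^esub> g))"
          unfolding mult[OF g]
          by (intro R.finsum_cong' refl) (use u v w g in \<open>auto simp: mult ap[OF u] ap[OF v] ap[OF w] intro!: R.finsum_closed\<close>)
        also have "\<dots> = (\<Oplus>\<^bsub>F\<^esub>h\<in>?c. \<Oplus>\<^bsub>F\<^esub>l\<in>?c. u l \<otimes>\<^bsub>F\<^esub> v (inv\<^bsub>G\<^esub> l \<otimes>\<^bsub>G\<^esub> h) \<otimes>\<^bsub>F\<^esub> w (inv\<^bsub>G\<^esub> h \<otimes>\<^bsub>G\<^esub> g))"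
          by (intro R.finsum_cong' refl R.finsum_ldistr fin)
             (use u v w g in \<open>auto simp: ap[OF u] ap[OF v] ap[OF w] intro!: R.finsum_closed\<close>)
        also have "\<dots> = (\<Oplus>\<^bsub>F\<^esub>l\<in>?c. \<Oplus>\<^bsub>F\<^esub>h\<in>?c. u l \<otimes>\<^bsub>F\<^esub> v (inv\<^bsub>G\<^esub> l \<otimes>\<^bsub>G\<^esub> h) \<otimes>\<^bsub>F\<^esub> w (inv\<^bsub>G\<^esub> h \<otimes>\<^bsub>G\<^esub> g))"
          by (intro R.finsum_exchange fin) (use u v w g in \<open>auto simp: ap[OF u] ap[OF v] ap[OF w]\<close>)
        also have "\<dots> = (\<Oplus>\<^bsub>F\<^esub>l\<in>?c. u l \<otimes>\<^bsub>F\<^esub> (\<Oplus>\<^bsub>F\<^esub>m\<in>?c. v m \<otimes>\<^bsub>F\<^esub> w (inv\<^bsub>G\<^esub> m \<otimes>\<^bsub>G\<^esub> (inv\<^bsub>G\<^esub> l \<otimes>\<^bsub>G\<^esub> g))))"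
        proof (intro R.finsum_cong' refl)
          fix l assume l: "l \<in> ?c"
          have bij: "(\<lambda>m. l \<otimes>\<^bsub>G\<^esub> m) ` ?c = ?c" "inj_on (\<lambda>m. l \<otimes>\<^bsub>G\<^esub> m) ?c"
            using l surj_const_mult inj_on_multc by (auto simp: inj_on_def)
          have "(\<Oplus>\<^bsub>F\<^esub>h\<in>?c. u l \<otimes>\<^bsub>F\<^esub> v (inv\<^bsub>G\<^esub> l \<otimes>\<^bsub>G\<^esub> h) \<otimes>\<^bsub>F\<^esub> w (inv\<^bsub>G\<^esub> h \<otimes>\<^bsub>G\<^esub> g))
            = (\<Oplus>\<^bsub>F\<^esub>h\<in>(\<lambda>m. l \<otimes>\<^bsub>G\<^esub> m) ` ?c. u l \<otimes>\<^bsub>F\<^esub> v (inv\<^bsub>G\<^esub> l \<otimes>\<^bsub>G\<^esub> h) \<otimes>\<^bsub>F\<^esub> w (inv\<^bsub>G\<^esub> h \<otimes>\<^bsub>G\<^esub> g))"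
            by (simp add: bij)
          also have "\<dots> = (\<Oplus>\<^bsub>F\<^esub>m\<in>?c. u l \<otimes>\<^bsub>F\<^esub> v (inv\<^bsub>G\<^esub> l \<otimes>\<^bsub>G\<^esub> (l \<otimes>\<^bsub>G\<^esub> m)) \<otimes>\<^bsub>F\<^esub> w (inv\<^bsub>G\<^esub> (l \<otimes>\<^bsub>G\<^esub> m) \<otimes>\<^bsub>G\<^esub> g))"
            by (rule R.finsum_reindex) (use u v w g l bij in \<open>auto simp: ap[OF u] ap[OF v] ap[OF w]\<close>)
          also have "\<dots> = (\<Oplus>\<^bsub>F\<^esub>m\<in>?c. u l \<otimes>\<^bsub>F\<^esub> (v m \<otimes>\<^bsub>F\<^esub> w (inv\<^bsub>G\<^esub> m \<otimes>\<^bsub>G\<^esub> (inv\<^bsub>G\<^esub> l \<otimes>\<^bsub>G\<^esub> g))))"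
            by (intro R.finsum_cong' refl)
               (use u v w g l in \<open>auto simp: ap[OF u] ap[OF v] ap[OF w] m_assoc[symmetric] inv_mult_group R.m_assoc\<close>)
          also have "\<dots> = u l \<otimes>\<^bsub>F\<^esub> (\<Oplus>\<^bsub>F\<^esub>m\<in>?c. v m \<otimes>\<^bsub>F\<^esub> w (inv\<^bsub>G\<^esub> m \<otimes>\<^bsub>G\<^esub> (inv\<^bsub>G\<^esub> l \<otimes>\<^bsub>G\<^esub> g)))"
            by (intro R.finsum_rdistr[symmetric] fin) (use u v w g l in \<open>auto simp: ap[OF u] ap[OF v] ap[OF w]\<close>)
          finally show "(\<Oplus>\<^bsub>F\<^esub>h\<in>?c. u l \<otimes>\<^bsub>F\<^esub> v (inv\<^bsub>G\<^esub> l \<otimes>\<^bsub>G\<^esub> h) \<otimes>\<^bsub>F\<^esub> w (inv\<^bsub>G\<^esub> h \<otimes>\<^bsub>G\<^esub> g))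
            = u l \<otimes>\<^bsub>F\<^esub> (\<Oplus>\<^bsub>F\<^esub>m\<in>?c. v m \<otimes>\<^bsub>F\<^esub> w (inv\<^bsub>G\<^esub> m \<otimes>\<^bsub>G\<^esub> (inv\<^bsub>G\<^esub> l \<otimes>\<^bsub>G\<^esub> g)))" .
        qed (use u v w g in \<open>auto simp: ap[OF u] ap[OF v] ap[OF w] intro!: R.finsum_closed R.m_closed\<close>)
        also have "\<dots> = (u \<otimes>\<^bsub>group_algebra F G\<^esub> (v \<otimes>\<^bsub>group_algebra F G\<^esub> w)) g"
          unfolding mult[OF g]
          by (intro R.finsum_cong' refl) (use u v w g in \<open>auto simp: mult ap[OF u] ap[OF v] ap[OF w] intro!: R.finsum_closed\<close>)
        finally show "(u \<otimes>\<^bsub>group_algebra F G\<^esub> v \<otimes>\<^bsub>group_algebra F G\<^esub> w) g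
          = (u \<otimes>\<^bsub>group_algebra F G\<^esub> (v \<otimes>\<^bsub>group_algebra F G\<^esub> w)) g" .
      qed
    next
      fix u assume u: "u \<in> carrier (group_algebra F G)"
      show "\<one>\<^bsub>group_algebra F G\<^esub> \<otimes>\<^bsub>group_algebra F G\<^esub> u = u"
      proof (intro eqI mult_cl one_cl u)
        fix g assume g: "g \<in> carrier G"
        have "(\<one>\<^bsub>group_algebra F G\<^esub> \<otimes>\<^bsub>group_algebra F G\<^esub> u) g
          = (\<Oplus>\<^bsub>F\<^esub>h\<in>carrier G. if \<one>\<^bsub>G\<^esub> = h then u (inv\<^bsub>G\<^esub> h \<otimes>\<^bsub>G\<^esub> g) else \<zero>\<^bsub>F\<^esub>)"
          unfolding mult[OF g]
          by (intro R.finsum_cong' refl) (use u g in \<open>auto simp: one ap[OF u]\<close>)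
        also have "\<dots> = u (inv\<^bsub>G\<^esub> \<one>\<^bsub>G\<^esub> \<otimes>\<^bsub>G\<^esub> g)"
          by (rule R.finsum_singleton) (use u g fin in \<open>auto simp: ap[OF u]\<close>)
        finally show "(\<one>\<^bsub>group_algebra F G\<^esub> \<otimes>\<^bsub>group_algebra F G\<^esub> u) g = u g" using g by simp
      qed
      show "u \<otimes>\<^bsub>group_algebra F G\<^esub> \<one>\<^bsub>group_algebra F G\<^esub> = u"
      proof (intro eqI mult_cl one_cl u)
        fix g assume g: "g \<in> carrier G"
        have iff: "inv\<^bsub>G\<^esub> h \<otimes>\<^bsub>G\<^esub> g = \<one>\<^bsub>G\<^esub> \<longleftrightarrow> g = h" if "h \<in> carrier G" for h
          using that g by (metis inv_closed inv_comm inv_equality inv_inv l_inv)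
        have "(u \<otimes>\<^bsub>group_algebra F G\<^esub> \<one>\<^bsub>group_algebra F G\<^esub>) g
          = (\<Oplus>\<^bsub>F\<^esub>h\<in>carrier G. if g = h then u h else \<zero>\<^bsub>F\<^esub>)"
          unfolding mult[OF g]
          by (intro R.finsum_cong' refl) (use u g in \<open>auto simp: one ap[OF u] iff\<close>)
        also have "\<dots> = u g"
          by (rule R.finsum_singleton) (use u g fin in \<open>auto simp: ap[OF u]\<close>)
        finally show "(u \<otimes>\<^bsub>group_algebra F G\<^esub> \<one>\<^bsub>group_algebra F G\<^esub>) g = u g" .
      qed
    qed (use mult_cl one_cl in auto)
  next
    fix u v w
    assume u: "u \<in> carrier (group_algebra F G)" and v: "v \<in> carrier (group_algebra F G)"
      and w: "w \<in> carrier (group_algebra F G)"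
    show "(u \<oplus>\<^bsub>group_algebra F G\<^esub> v) \<otimes>\<^bsub>group_algebra F G\<^esub> w
      = u \<otimes>\<^bsub>group_algebra F G\<^esub> w \<oplus>\<^bsub>group_algebra F G\<^esub> v \<otimes>\<^bsub>group_algebra F G\<^esub> w"
    proof (intro eqI mult_cl add_cl u v w)
      fix g assume g: "g \<in> carrier G"
      show "((u \<oplus>\<^bsub>group_algebra F G\<^esub> v) \<otimes>\<^bsub>group_algebra F G\<^esub> w) g
        = (u \<otimes>\<^bsub>group_algebra F G\<^esub> w \<oplus>\<^bsub>group_algebra F G\<^esub> v \<otimes>\<^bsub>group_algebra F G\<^esub> w) g"
        unfolding mult[OF g] add[OF g]
      proof -
        have "(\<Oplus>\<^bsub>F\<^esub>h\<in>carrier G. (u \<oplus>\<^bsub>group_algebra F G\<^esub> v) h \<otimes>\<^bsub>F\<^esub> w (inv\<^bsub>G\<^esub> h \<otimes>\<^bsub>G\<^esub> g))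
          = (\<Oplus>\<^bsub>F\<^esub>h\<in>carrier G. u h \<otimes>\<^bsub>F\<^esub> w (inv\<^bsub>G\<^esub> h \<otimes>\<^bsub>G\<^esub> g) \<oplus>\<^bsub>F\<^esub> v h \<otimes>\<^bsub>F\<^esub> w (inv\<^bsub>G\<^esub> h \<otimes>\<^bsub>G\<^esub> g))"
          by (intro R.finsum_cong' refl) (use g in \<open>auto simp: add ap[OF u] ap[OF v] ap[OF w] R.l_distr\<close>)
        also have "\<dots> = (\<Oplus>\<^bsub>F\<^esub>h\<in>carrier G. u h \<otimes>\<^bsub>F\<^esub> w (inv\<^bsub>G\<^esub> h \<otimes>\<^bsub>G\<^esub> g)) \<oplus>\<^bsub>F\<^esub> (\<Oplus>\<^bsub>F\<^esub>h\<in>carrier G. v h \<otimes>\<^bsub>F\<^esub> w (inv\<^bsub>G\<^esub> h \<otimes>\<^bsub>G\<^esub> g))"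
          by (intro R.finsum_addf) (use g in \<open>auto simp: ap[OF u] ap[OF v] ap[OF w]\<close>)
        finally show "(\<Oplus>\<^bsub>F\<^esub>h\<in>carrier G. (u \<oplus>\<^bsub>group_algebra F G\<^esub> v) h \<otimes>\<^bsub>F\<^esub> w (inv\<^bsub>G\<^esub> h \<otimes>\<^bsub>G\<^esub> g)) = \<dots>" .
      qed
    qed
    show "w \<otimes>\<^bsub>group_algebra F G\<^esub> (u \<oplus>\<^bsub>group_algebra F G\<^esub> v)
      = w \<otimes>\<^bsub>group_algebra F G\<^esub> u \<oplus>\<^bsub>group_algebra F G\<^esub> w \<otimes>\<^bsub>group_algebra F G\<^esub> v"
    proof (intro eqI mult_cl add_cl u v w)
      fix g assume g: "g \<in> carrier G"
      show "(w \<otimes>\<^bsub>group_algebra F G\<^esub> (u \<oplus>\<^bsub>group_algebra F G\<^esub> v)) g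
        = (w \<otimes>\<^bsub>group_algebra F G\<^esub> u \<oplus>\<^bsub>group_algebra F G\<^esub> w \<otimes>\<^bsub>group_algebra F G\<^esub> v) g"
        unfolding mult[OF g] add[OF g]
      proof -
        have "(\<Oplus>\<^bsub>F\<^esub>h\<in>carrier G. w h \<otimes>\<^bsub>F\<^esub> (u \<oplus>\<^bsub>group_algebra F G\<^esub> v) (inv\<^bsub>G\<^esub> h \<otimes>\<^bsub>G\<^esub> g))
          = (\<Oplus>\<^bsub>F\<^esub>h\<in>carrier G. w h \<otimes>\<^bsub>F\<^esub> u (inv\<^bsub>G\<^esub> h \<otimes>\<^bsub>G\<^esub> g) \<oplus>\<^bsub>F\<^esub> w h \<otimes>\<^bsub>F\<^esub> v (inv\<^bsub>G\<^esub> h \<otimes>\<^bsub>G\<^esub> g))"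
          by (intro R.finsum_cong' refl) (use g in \<open>auto simp: add ap[OF u] ap[OF v] ap[OF w] R.r_distr\<close>)
        also have "\<dots> = (\<Oplus>\<^bsub>F\<^esub>h\<in>carrier G. w h \<otimes>\<^bsub>F\<^esub> u (inv\<^bsub>G\<^esub> h \<otimes>\<^bsub>G\<^esub> g)) \<oplus>\<^bsub>F\<^esub> (\<Oplus>\<^bsub>F\<^esub>h\<in>carrier G. w h \<otimes>\<^bsub>F\<^esub> v (inv\<^bsub>G\<^esub> h \<otimes>\<^bsub>G\<^esub> g))"
          by (intro R.finsum_addf) (use g in \<open>auto simp: ap[OF u] ap[OF v] ap[OF w]\<close>)
        finally show "(\<Oplus>\<^bsub>F\<^esub>h\<in>carrier G. w h \<otimes>\<^bsub>F\<^esub> (u \<oplus>\<^bsub>group_algebra F G\<^esub> v) (inv\<^bsub>G\<^esub> h \<otimes>\<^bsub>G\<^esub> g)) = \<dots>" .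
      qed
    qed
  qed
qed

end

theory Submission
  imports Defs "HOL-Algebra.Subrings"
begin

text \<open>
  The map \<open>Y\<^sup>g \<mapsto> Y\<^sup>-\<^sup>g\<close> extends to an involution \<open>u \<mapsto> u*\<close> of the group algebra, and an ideal \<open>C\<close> has dual
  \<open>{v. \<forall>c\<in>C. c* v = 0}\<close>. Let \<open>m = p\<^sup>\<nu>\<close>. By the Frobenius map, \<open>(\<Sum> u\<^sub>g Y\<^sup>g)\<^sup>m = \<Sum> u\<^sub>g Y\<^sup>m\<^sup>g\<close>, so some power \<open>M > 1\<close>
  of \<open>m\<close> satisfies \<open>u\<^sup>M = u\<close> for all \<open>u\<close>; then \<open>u\<^sup>M\<^sup>-\<^sup>1\<close> is an idempotent generating the same ideal as
  \<open>u\<close>, and every ideal is generated by a unique idempotent \<open>e\<close>. It is complementary dual iff \<open>e* = e\<close>,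
  so no decomposition of the algebra into fields is needed: it suffices to count self-adjoint
  idempotents. They lie in the subring \<open>B\<close> of all \<open>u\<close> with \<open>u\<^sup>m = u = u*\<close>, which consists of the
  functions that are constant on the sets \<open>S(a) \<union> S(-a)\<close>. There are \<open>r\<^sub>I + r\<^sub>I\<^sub>I\<close> such sets, so \<open>B\<close> has
  \<open>m\<close> to the power \<open>r\<^sub>I + r\<^sub>I\<^sub>I\<close> elements; since \<open>x\<^sup>m = x\<close> on \<open>B\<close>, it is a product of copies of the base field
  and has \<open>2\<close> to the power \<open>r\<^sub>I + r\<^sub>I\<^sub>I\<close> idempotents.

  For the class counts, the class of an element of order \<open>q\<^sup>i\<close> has as many elements as the order of \<open>m\<close>
  modulo \<open>q\<^sup>i\<close>, and it is of type \<open>I\<close> iff \<open>-1\<close> is a power of \<open>m\<close> modulo \<open>q\<^sup>i\<close>; for \<open>i > 0\<close> this happens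
  iff \<open>m\<close> has even order modulo \<open>q\<close>.
\<close>

section \<open>Idempotents of finite commutative rings\<close>

lemma (in cring) binomial_theorem:
  assumes x: "x \<in> carrier R" and y: "y \<in> carrier R"
  shows "(x \<oplus> y) [^] n = (\<Oplus>k\<in>{..n}. [(n choose k)] \<cdot> (x [^] k \<otimes> y [^] (n - k)))"
proof (induction n)
  case 0
  then show ?case by (simp add: x y)
next
  case (Suc n)
  \<comment> \<open>\<open>U\<close> and \<open>V\<close> are the terms of the expansion for
    \<open>n\<close> multiplied by \<open>y\<close> and by \<open>x\<close>, both indexed by the new
    exponent of \<open>x\<close>. The default \<open>V 0 = \<zero>\<close> and the vanishing of
    \<open>n choose Suc n\<close> let both sums run over \<open>{..Suc n}\<close>, where Pascal's
    rule adds them term by term.\<close>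
  define U where "U k = [(n choose k)] \<cdot> (x [^] k \<otimes> y [^] (Suc n - k))" for k
  define V where "V k = (if k = 0 then \<zero> else [(n choose (k - 1))] \<cdot> (x [^] k \<otimes> y [^] (Suc n - k)))" for k
  have U: "U k \<in> carrier R" for k by (simp add: U_def x y)
  have V: "V k \<in> carrier R" for k by (simp add: V_def x y)
  have t: "[(n choose k)] \<cdot> (x [^] k \<otimes> y [^] (n - k)) \<in> carrier R" for k
    by (simp add: x y)
  have "(\<Oplus>k\<in>{..n}. [(n choose k)] \<cdot> (x [^] k \<otimes> y [^] (n - k))) \<otimes> y = (\<Oplus>k\<in>{..n}. U k)"
  proof (subst finsum_ldistr)
    show "(\<Oplus>k\<in>{..n}. [(n choose k)] \<cdot> (x [^] k \<otimes> y [^] (n - k)) \<otimes> y) = (\<Oplus>k\<in>{..n}. U k)"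
    proof (intro finsum_cong' refl)
      fix k assume "k \<in> {..n}"
      then have "y [^] (Suc n - k) = y [^] (n - k) \<otimes> y" by (simp add: Suc_diff_le)
      then show "[(n choose k)] \<cdot> (x [^] k \<otimes> y [^] (n - k)) \<otimes> y = U k"
        by (simp add: U_def add_pow_ldistr x y m_assoc)
    qed (simp add: U)
  qed (auto simp: x y)
  also have "\<dots> = (\<Oplus>k\<in>{..Suc n}. U k)"
    by (subst finsum_Suc) (auto simp: U_def x y binomial_eq_0)
  finally have 1: "(\<Oplus>k\<in>{..n}. [(n choose k)] \<cdot> (x [^] k \<otimes> y [^] (n - k))) \<otimes> y = (\<Oplus>k\<in>{..Suc n}. U k)" .
  have "(\<Oplus>k\<in>{..n}. [(n choose k)] \<cdot> (x [^] k \<otimes> y [^] (n - k))) \<otimes> x = (\<Oplus>k\<in>{..n}. V (Suc k))"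
  proof (subst finsum_ldistr)
    have "x [^] k \<otimes> y [^] (n - k) \<otimes> x = x [^] k \<otimes> x \<otimes> y [^] (n - k)" for k
      by (simp add: m_ac x y)
    then show "(\<Oplus>k\<in>{..n}. [(n choose k)] \<cdot> (x [^] k \<otimes> y [^] (n - k)) \<otimes> x) = (\<Oplus>k\<in>{..n}. V (Suc k))"
      by (intro finsum_cong' refl) (auto simp: V_def add_pow_ldistr x y)
  qed (auto simp: x y)
  also have "\<dots> = (\<Oplus>k\<in>{..Suc n}. V k)"
    by (subst finsum_Suc2) (use V V[of "Suc _"] in \<open>auto simp: V_def[of 0] intro!: finsum_closed r_zero[symmetric]\<close>)
  finally have 2: "(\<Oplus>k\<in>{..n}. [(n choose k)] \<cdot> (x [^] k \<otimes> y [^] (n - k))) \<otimes> x = (\<Oplus>k\<in>{..Suc n}. V k)" .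
  have "(x \<oplus> y) [^] Suc n = (\<Oplus>k\<in>{..Suc n}. V k) \<oplus> (\<Oplus>k\<in>{..Suc n}. U k)"
    by (simp only: nat_pow_Suc Suc.IH 1[symmetric] 2[symmetric])
       (intro r_distr, auto simp: x y)
  also have "\<dots> = (\<Oplus>k\<in>{..Suc n}. V k \<oplus> U k)"
    by (rule finsum_addf[symmetric]) (auto simp: U V)
  also have "\<dots> = (\<Oplus>k\<in>{..Suc n}. [(Suc n choose k)] \<cdot> (x [^] k \<otimes> y [^] (Suc n - k)))"
  proof (intro finsum_cong' refl)
    fix k
    show "V k \<oplus> U k = [(Suc n choose k)] \<cdot> (x [^] k \<otimes> y [^] (Suc n - k))"
      by (cases k) (auto simp: U_def V_def x y add.nat_pow_mult)
  qed (auto simp: x y)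
  finally show ?case .
qed

text \<open>The prime \<open>p\<close> divides every inner binomial coefficient, so only the two
  extreme terms of the expansion survive.\<close>

lemma (in cring) frobenius_add:
  assumes p: "prime (p::nat)" and char: "[p] \<cdot> \<one> = \<zero>" and x: "x \<in> carrier R" and y: "y \<in> carrier R"
  shows "(x \<oplus> y) [^] p = x [^] p \<oplus> y [^] p"
proof -
  have z: "[k] \<cdot> z = \<zero>" if "p dvd k" "z \<in> carrier R" for k :: nat and z
  proof -
    from that obtain l where l: "k = p * l" by auto
    have "[p] \<cdot> z = [p] \<cdot> (\<one> \<otimes> z)" using that by simp
    also have "\<dots> = \<zero>" using that char by (simp only: add_pow_ldistr[symmetric] one_closed) simp
    finally show ?thesis using that unfolding l
      by (simp add: add.nat_pow_pow[symmetric])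
  qed
  obtain n where n: "p = Suc n" using prime_gt_0_nat[OF p] gr0_implies_Suc by blast
  have "(x \<oplus> y) [^] p = (\<Oplus>k\<in>{..Suc n}. [(p choose k)] \<cdot> (x [^] k \<otimes> y [^] (p - k)))"
    using binomial_theorem[OF x y, of p] n by simp
  also have "\<dots> = x [^] p \<oplus> (\<Oplus>k\<in>{..n}. [(p choose k)] \<cdot> (x [^] k \<otimes> y [^] (p - k)))"
    by (subst finsum_Suc) (auto simp: n x y)
  also have "(\<Oplus>k\<in>{..n}. [(p choose k)] \<cdot> (x [^] k \<otimes> y [^] (p - k)))
      = (\<Oplus>k\<in>{..n}. if 0 = k then y [^] p else \<zero>)"
  proof (intro finsum_cong' refl)
    fix k assume k: "k \<in> {..n}"
    show "[(p choose k)] \<cdot> (x [^] k \<otimes> y [^] (p - k)) = (if 0 = k then y [^] p else \<zero>)"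
    proof (cases "k = 0")
      case False
      then have "p dvd (p choose k)" using k n p by (intro dvd_choose_prime) auto
      with False show ?thesis by (simp add: z x y)
    qed (simp add: x y)
  qed (auto simp: x y)
  also have "\<dots> = y [^] p"
    by (rule finsum_singleton) (auto simp: y)
  finally show ?thesis .
qed

lemma (in cring) frobenius_power_add:
  assumes p: "prime (p::nat)" and char: "[p] \<cdot> \<one> = \<zero>" and x: "x \<in> carrier R" and y: "y \<in> carrier R"
  shows "(x \<oplus> y) [^] (p ^ n) = x [^] (p ^ n) \<oplus> y [^] (p ^ n)"
proof (induction n)
  case 0
  then show ?case by (simp add: x y)
next
  case (Suc n)
  have *: "z [^] (p ^ Suc n) = (z [^] (p ^ n)) [^] p" if "z \<in> carrier R" for z
    using that by (simp add: nat_pow_pow mult.commute)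
  show ?case
    using Suc by (simp only: * x y a_closed) (simp add: frobenius_add[OF p char] x y)
qed

lemma (in cring) frobenius_power_finsum:
  assumes p: "prime (p::nat)" and char: "[p] \<cdot> \<one> = \<zero>"
    and "finite A" and "\<And>i. i \<in> A \<Longrightarrow> f i \<in> carrier R"
  shows "(\<Oplus>i\<in>A. f i) [^] (p ^ n) = (\<Oplus>i\<in>A. f i [^] (p ^ n))"
  using assms(3,4)
proof (induction A rule: finite_induct)
  case empty
  then show ?case using prime_gt_0_nat[OF p] by (simp add: nat_pow_zero)
next
  case (insert a A)
  then show ?case
    by (simp add: finsum_insert frobenius_power_add[OF p char] Pi_def finsum_closed)
qed

text \<open>Enlarging \<open>e\<close> to \<open>e + f - ef\<close>, with \<open>f = x\<^sup>n\<close>, captures one more element of the ideal.\<close>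

lemma (in cring) ideal_generated_by_idempotent:
  assumes fin: "finite (carrier R)" and C: "ideal C R" and n: "n > 0"
    and pow: "\<And>x. x \<in> carrier R \<Longrightarrow> x [^] Suc n = x"
  shows "\<exists>e\<in>C. e \<otimes> e = e \<and> (\<forall>x\<in>C. e \<otimes> x = x)"
proof -
  interpret ideal C R by fact
  have sub: "x \<in> carrier R" if "x \<in> C" for x using that a_Hcarr by blast
  have "finite C" using fin sub by (meson finite_subset subsetI)
  \<comment> \<open>Induction over the finite subsets \<open>S\<close> of \<open>C\<close>: the
    idempotent only has to act as identity on \<open>S\<close>, and \<open>S = C\<close> gives the
    claim.\<close>
  have "S \<subseteq> C \<Longrightarrow> \<exists>e\<in>C. e \<otimes> e = e \<and> (\<forall>x\<in>S. e \<otimes> x = x)" if "finite S" for S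
    using that
  proof (induction S rule: finite_induct)
    case empty
    then show ?case by (intro bexI[of _ \<zero>]) auto
  next
    case (insert a S)
    then obtain e where e: "e \<in> C" "e \<otimes> e = e" "\<forall>x\<in>S. e \<otimes> x = x" by auto
    have S: "x \<in> carrier R" if "x \<in> S" for x
      using that insert.prems sub by auto
    define f where "f = a [^] n"
    have ec: "e \<in> carrier R" using e sub by auto
    obtain k where k: "n = Suc k" using n gr0_implies_Suc by blast
    have ac: "a \<in> carrier R" "a \<in> C" using insert sub by auto
    have fa: "f \<otimes> a = a" using pow[of a] ac by (simp add: f_def)
    have fC: "f \<in> C" using ac unfolding f_def k by (simp add: I_l_closed)
    have fc: "f \<in> carrier R" using fC sub by auto
    have ff: "f \<otimes> f = f"
    proof -
      \<comment> \<open>With \<open>n = k + 1\<close>: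
        \<open>a^(2n) = a^(n+1) a^k = a a^k = a^n\<close>.\<close>
      have "f \<otimes> f = a [^] Suc n \<otimes> a [^] k"
        using ac by (simp only: f_def k nat_pow_mult) simp
      also have "\<dots> = a [^] Suc k"
        using ac pow[of a] by (simp add: m_comm)
      finally show ?thesis by (simp add: f_def k)
    qed
    define g where "g = e \<oplus> f \<ominus> e \<otimes> f"
    have gC: "g \<in> C" unfolding g_def a_minus_def
      using e fC ec fc by (intro a_closed additive_subgroup.a_inv_closed) (auto simp: I_l_closed additive_subgroup_axioms)
    have gx: "g \<otimes> x = e \<otimes> x \<oplus> f \<otimes> x \<ominus> e \<otimes> f \<otimes> x" if "x \<in> carrier R" for x
      using that ec fc unfolding g_def by algebra
    have ge: "g \<otimes> e = e" 
    proof -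
      have "g \<otimes> e = e \<otimes> e \<oplus> f \<otimes> e \<ominus> f \<otimes> (e \<otimes> e)"
        using ec fc unfolding g_def by algebra
      also have "\<dots> = e" using ec fc unfolding e(2) by algebra
      finally show ?thesis .
    qed
    have gf: "g \<otimes> f = f" 
    proof -
      have "g \<otimes> f = e \<otimes> f \<oplus> f \<otimes> f \<ominus> e \<otimes> (f \<otimes> f)"
        using ec fc unfolding g_def by algebra
      also have "\<dots> = f" using ec fc unfolding ff by algebra
      finally show ?thesis .
    qed
    have gc: "g \<in> carrier R" using gC sub by auto
    \<comment> \<open>Writing the second factor of \<open>g g\<close> as \<open>e + f - ef\<close>
      reduces idempotence to \<open>ge\<close> and \<open>gf\<close>.\<close>
    have "g \<otimes> (e \<oplus> f \<ominus> e \<otimes> f) = g \<otimes> e \<oplus> g \<otimes> f \<ominus> g \<otimes> e \<otimes> f"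
      using ec fc gc by algebra
    then have "g \<otimes> g = g" by (simp only: ge gf g_def[symmetric])
    moreover have "g \<otimes> a = a" using gf fa gc fc ac by (metis m_assoc)
    moreover have "g \<otimes> x = x" if "x \<in> S" for x
      using ge e(3) gc ec S[OF that] that by (metis m_assoc)
    ultimately show ?case using gC by blast
  qed
  from this[OF \<open>finite C\<close> subset_refl] show ?thesis .
qed

text \<open>Induction on the size of the corner ring \<open>eR\<close>: a primitive \<open>e\<close> gives a field in which every
  nonzero element is a root of \<open>X\<^sup>n - 1\<close>, any other \<open>e\<close> splits into two smaller corners.\<close>

lemma (in cring) card_idempotents_below:
  assumes fin: "finite (carrier R)" and n: "n > 0"
    and pow: "\<And>x. x \<in> carrier R \<Longrightarrow> x [^] Suc n = x"
    and large: "\<And>e. e \<in> carrier R \<Longrightarrow> e \<otimes> e = e \<Longrightarrow> e \<noteq> \<zero> \<Longrightarrow> Suc n \<le> card {x \<in> carrier R. e \<otimes> x = x}"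
    and "e \<in> carrier R" and "e \<otimes> e = e"
  shows "\<exists>a. card {x \<in> carrier R. e \<otimes> x = x} = Suc n ^ a \<and>
             card {f \<in> carrier R. f \<otimes> f = f \<and> e \<otimes> f = f} = 2 ^ a"
  using assms(5,6)
proof (induction "card {x \<in> carrier R. e \<otimes> x = x}" arbitrary: e rule: less_induct)
  case less
  note e = less.prems
  define B where "B e = {x \<in> carrier R. e \<otimes> x = x}" for e
  define I where "I e = {f \<in> carrier R. f \<otimes> f = f \<and> e \<otimes> f = f}" for e
  have finB: "finite (B f)" and finI: "finite (I f)" for f using fin by (auto simp: B_def I_def)
  consider (zero) "e = \<zero>" | (prim) "e \<noteq> \<zero>" "\<And>f. f \<in> I e \<Longrightarrow> f = \<zero> \<or> f = e"
    | (split) f where "f \<in> I e" "f \<noteq> \<zero>" "f \<noteq> e" by blast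
  then have "\<exists>a. card (B e) = Suc n ^ a \<and> card (I e) = 2 ^ a"
  proof cases
    case zero
    have "B \<zero> = {\<zero>}" "I \<zero> = {\<zero>}" by (auto simp: B_def I_def)
    then show ?thesis using zero by (intro exI[of _ 0]) simp
  next
    case prim
    have "I e = {\<zero>, e}" using prim e by (auto simp: I_def)
    then have cI: "card (I e) = 2" using prim by auto
    have pow_idem: "x [^] n \<in> I e" if x: "x \<in> B e" for x
    proof -
      obtain k where k: "n = Suc k" using n gr0_implies_Suc by blast
      have xc: "x \<in> carrier R" and ex: "e \<otimes> x = x" using x by (auto simp: B_def)
      have "x [^] n \<otimes> x [^] n = x [^] Suc n \<otimes> x [^] k"
        using xc by (simp only: k nat_pow_mult) simp
      also have "\<dots> = x [^] n" using xc pow[of x] by (simp add: k m_comm)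
      finally have 1: "x [^] n \<otimes> x [^] n = x [^] n" .
      have "e \<otimes> x [^] n = x [^] k \<otimes> (e \<otimes> x)"
        using xc e by (simp add: k m_lcomm)
      also have "\<dots> = x [^] n" using ex by (simp add: k)
      finally show ?thesis using 1 xc by (auto simp: I_def)
    qed
    have pow_unit: "x [^] n = e" if x: "x \<in> B e" "x \<noteq> \<zero>" for x
    proof -
      have "x [^] n \<noteq> \<zero>"
        using pow[of x] x by (auto simp: B_def)
      then show ?thesis using prim(2)[OF pow_idem[OF x(1)]] by blast
    qed
    \<comment> \<open>The corner \<open>eR\<close> with \<open>e\<close> as its unit.\<close>
    define D where "D = R\<lparr>carrier := B e, one := e\<rparr>"
    have "cring D"
    proof (rule cringI)
      show "abelian_group D"
      proof (rule abelian_groupI)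
        fix x assume x: "x \<in> carrier D"
        show "\<exists>y\<in>carrier D. y \<oplus>\<^bsub>D\<^esub> x = \<zero>\<^bsub>D\<^esub>"
          by (rule bexI[of _ "\<ominus> x"]) (use x e in \<open>auto simp: D_def B_def l_neg r_minus\<close>)
      qed (use e in \<open>auto simp: D_def B_def r_distr a_ac\<close>)
      show "Group.comm_monoid D"
        by (rule comm_monoidI) (use e in \<open>auto simp: D_def B_def m_ac simp flip: m_assoc[of e]\<close>)
    qed (use e in \<open>auto simp: D_def B_def l_distr\<close>)
    moreover have "domain_axioms D"
    proof
      show "\<one>\<^bsub>D\<^esub> \<noteq> \<zero>\<^bsub>D\<^esub>" using prim by (simp add: D_def)
      fix x y assume *: "x \<otimes>\<^bsub>D\<^esub> y = \<zero>\<^bsub>D\<^esub>" "x \<in> carrier D" "y \<in> carrier D"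
      obtain k where k: "n = Suc k" using n gr0_implies_Suc by blast
      show "x = \<zero>\<^bsub>D\<^esub> \<or> y = \<zero>\<^bsub>D\<^esub>"
      \<comment> \<open>A nonzero \<open>y\<close> has the inverse \<open>y^k\<close> in the corner,
        where \<open>n = k + 1\<close>, because \<open>y^n = e\<close>.\<close>
      proof (rule disjCI)
        assume "y \<noteq> \<zero>\<^bsub>D\<^esub>"
        then have "y [^] n = e" using * pow_unit by (simp add: D_def)
        then have "x = y [^] n \<otimes> x" using * by (simp add: D_def B_def)
        also have "\<dots> = y [^] k \<otimes> (y \<otimes> x)" using * by (simp add: k D_def B_def m_assoc)
        also have "y \<otimes> x = x \<otimes> y" using * by (simp add: D_def B_def m_comm)
        also have "y [^] k \<otimes> (x \<otimes> y) = \<zero>" using * by (simp add: D_def B_def)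
        finally show "x = \<zero>\<^bsub>D\<^esub>" by (simp add: D_def)
      qed
    qed
    ultimately interpret D: domain D by (rule domain.intro)
    \<comment> \<open>The two powers may differ at exponent 0, where \<open>D\<close> yields
      \<open>e\<close>; hence the induction starts at exponent 1.\<close>
    have pD: "x [^]\<^bsub>D\<^esub> n = x [^] n" if "x \<in> B e" for x
    proof -
      have "x [^]\<^bsub>D\<^esub> Suc j = x [^] Suc j" for j :: nat
        by (induction j) (use that in \<open>auto simp: D_def B_def\<close>)
      then show ?thesis using n gr0_implies_Suc by blast
    qed
    have "B e - {\<zero>} \<subseteq> {x \<in> carrier D. x [^]\<^bsub>D\<^esub> n = \<one>\<^bsub>D\<^esub>}"
      using pD pow_unit by (auto simp: D_def)
    moreover have "card {x \<in> carrier D. x [^]\<^bsub>D\<^esub> n = \<one>\<^bsub>D\<^esub>} \<le> n"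
      using n finB by (intro D.num_roots_le_deg) (auto simp: D_def)
    moreover have "finite {x \<in> carrier D. x [^]\<^bsub>D\<^esub> n = \<one>\<^bsub>D\<^esub>}"
      using finB[of e] by (auto simp: D_def)
    ultimately have "card (B e - {\<zero>}) \<le> n" using card_mono le_trans by blast
    then have "card (B e) \<le> Suc n" by (simp add: card_Diff_singleton_if split: if_splits)
    \<comment> \<open>The root bound gave one inequality and \<open>large\<close> gives the other,
      so the corner has exactly \<open>Suc n\<close> elements and two idempotents.\<close>
    moreover have "Suc n \<le> card (B e)" unfolding B_def using large e prim by blast
    ultimately show ?thesis using cI by (intro exI[of _ 1]) simp
  next
    case split
    \<comment> \<open>\<open>f\<close> and \<open>g\<close> are orthogonal idempotents with sum
      \<open>e\<close>, both different from \<open>e\<close>, so their corners are strictly smaller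
      than that of \<open>e\<close>.\<close>
    define g where "g = e \<ominus> f"
    have f: "f \<in> carrier R" "f \<otimes> f = f" "e \<otimes> f = f" using split by (auto simp: I_def)
    have g: "g \<in> carrier R" using e f by (simp add: g_def)
    have gf: "g \<otimes> f = \<zero>"
    proof -
      have "g \<otimes> f = e \<otimes> f \<ominus> f \<otimes> f" unfolding g_def using e f by algebra
      then show ?thesis using f by simp algebra
    qed
    have ge: "e \<otimes> g = g"
    proof -
      have "e \<otimes> g = e \<otimes> e \<ominus> e \<otimes> f" unfolding g_def using e f by algebra
      then show ?thesis unfolding g_def using e f by simp
    qed
    have gg: "g \<otimes> g = g"
    proof -
      have "g \<otimes> g = e \<otimes> g \<ominus> g \<otimes> f" unfolding g_def using e f by algebra
      then show ?thesis unfolding ge gf using g by simp algebra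
    qed
    have efg: "e = f \<oplus> g" unfolding g_def using e f by algebra
    have g0: "g \<noteq> \<zero>" "g \<noteq> e"
      using efg f(1) split(3) g gf f e split(2) by auto
    have fg: "f \<otimes> g = \<zero>" using gf f g m_comm by simp
    have sub: "B h \<subset> B e" if "h \<in> carrier R" "e \<otimes> h = h" "h \<noteq> e" for h
    proof -
      have "h \<otimes> e = h" using that e m_comm by simp
      then have "e \<in> B e - B h" using that e by (auto simp: B_def)
      moreover have "e \<otimes> x = x" if "h \<otimes> x = x" "x \<in> carrier R" for x
        using that e \<open>e \<otimes> h = h\<close> \<open>h \<in> carrier R\<close> by (metis m_assoc)
      then have "B h \<subseteq> B e" by (auto simp: B_def)
      ultimately show ?thesis by blast
    qed
    have "card (B f) < card (B e)" "card (B g) < card (B e)"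
      using psubset_card_mono[OF finB sub[OF f(1,3) split(3)]] psubset_card_mono[OF finB sub[OF g ge g0(2)]]
      by simp_all
    then obtain a b where a: "card (B f) = Suc n ^ a" "card (I f) = 2 ^ a"
      and b: "card (B g) = Suc n ^ b" "card (I g) = 2 ^ b"
      using less.hyps[of f] less.hyps[of g] f g gg unfolding B_def I_def by blast
    have sum: "f \<otimes> x \<oplus> g \<otimes> x = e \<otimes> x" if "x \<in> carrier R" for x
      using that f g efg l_distr by simp
    have proj: "f \<otimes> (x \<oplus> y) = x" "g \<otimes> (x \<oplus> y) = y" if "x \<in> B f" "y \<in> B g" for x y
    proof -
      have xy: "x \<in> carrier R" "y \<in> carrier R" "f \<otimes> x = x" "g \<otimes> y = y" using that by (auto simp: B_def)
      have "f \<otimes> y = \<zero>" using xy(4) fg xy f g by (metis m_assoc l_null)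
      moreover have "g \<otimes> x = \<zero>" using xy(3) gf xy f g by (metis m_assoc l_null)
      ultimately show "f \<otimes> (x \<oplus> y) = x" "g \<otimes> (x \<oplus> y) = y"
        using xy f g by (auto simp: r_distr)
    qed
    have fB: "f \<otimes> x \<in> B f" "g \<otimes> x \<in> B g" if "x \<in> carrier R" for x
      using that f g gg by (auto simp: B_def m_assoc[symmetric])
    have BI: "I h = {x \<in> B h. x \<otimes> x = x}" for h by (auto simp: B_def I_def)
    have addB: "x \<oplus> y \<in> B e" if "x \<in> B f" "y \<in> B g" for x y
    proof -
      have xy: "x \<oplus> y \<in> carrier R" using that by (auto simp: B_def)
      from sum[OF xy] proj[OF that] show ?thesis using xy by (simp add: B_def)
    qed
    \<comment> \<open>Peirce decomposition: an element of the corner corresponds to its components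
      in the two smaller corners, and addition is the inverse map.\<close>
    have bB: "bij_betw (\<lambda>x. (f \<otimes> x, g \<otimes> x)) (B e) (B f \<times> B g)"
      by (rule bij_betw_byWitness[where f' = "\<lambda>(x, y). x \<oplus> y"])
         (use fB addB proj sum in \<open>auto simp: B_def\<close>)
    have sq: "h \<otimes> x \<otimes> (h \<otimes> x) = h \<otimes> (x \<otimes> x)" if "x \<in> carrier R" "h \<in> carrier R" "h \<otimes> h = h" for x h
    proof -
      have "h \<otimes> x \<otimes> (h \<otimes> x) = (h \<otimes> h) \<otimes> (x \<otimes> x)" using that(1,2) by algebra
      then show ?thesis using that by simp
    qed
    have addI: "x \<oplus> y \<in> I e" if "x \<in> I f" "y \<in> I g" for x y
    proof -
      have xB: "x \<in> B f" "y \<in> B g" and xx: "x \<otimes> x = x" "y \<otimes> y = y" using that by (auto simp: BI)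
      have c: "x \<in> carrier R" "y \<in> carrier R" "x \<oplus> y \<in> carrier R" using xB by (auto simp: B_def)
      \<comment> \<open>Both projections commute with squaring, so \<open>?z\<close> and
        \<open>x \<oplus> y\<close> have the same components and coincide.\<close>
      let ?z = "(x \<oplus> y) \<otimes> (x \<oplus> y)"
      have z: "?z \<in> carrier R" "e \<otimes> ?z = ?z"
        using addB[OF xB] e c by (auto simp: B_def m_assoc[symmetric])
      have "f \<otimes> ?z = x" "g \<otimes> ?z = y"
        using sq[OF c(3) f(1,2)] sq[OF c(3) g gg] proj[OF xB] xx by auto
      then have "?z = x \<oplus> y" using sum[OF z(1)] z by simp
      then show ?thesis using addB[OF xB] by (simp add: BI)
    qed
    have fI: "f \<otimes> x \<in> I f" "g \<otimes> x \<in> I g" if "x \<in> I e" for x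
    proof -
      have x: "x \<in> carrier R" "x \<otimes> x = x" using that by (auto simp: I_def)
      show "f \<otimes> x \<in> I f" using fB(1)[OF x(1)] sq[OF x(1) f(1,2)] unfolding BI x(2) by blast
      show "g \<otimes> x \<in> I g" using fB(2)[OF x(1)] sq[OF x(1) g gg] unfolding BI x(2) by blast
    qed
    have bI: "bij_betw (\<lambda>x. (f \<otimes> x, g \<otimes> x)) (I e) (I f \<times> I g)"
      by (rule bij_betw_byWitness[where f' = "\<lambda>(x, y). x \<oplus> y"])
         (use fI addI proj sum in \<open>auto simp: BI B_def\<close>)
    have "card (B e) = Suc n ^ (a + b)"
      using bij_betw_same_card[OF bB] a b by (simp add: card_cartesian_product power_add)
    moreover have "card (I e) = 2 ^ (a + b)"
      using bij_betw_same_card[OF bI] a b by (simp add: card_cartesian_product power_add)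
    ultimately show ?thesis by blast
  qed
  then show ?case by (simp add: B_def I_def)
qed

text \<open>The corner of the idempotent \<open>\<one>\<close> is the whole ring, and the exponent
  is determined by the cardinality since \<open>Suc n > 1\<close>.\<close>

lemma (in cring) card_idempotents:
  assumes fin: "finite (carrier R)" and n: "n > 0"
    and pow: "\<And>x. x \<in> carrier R \<Longrightarrow> x [^] Suc n = x"
    and large: "\<And>e. e \<in> carrier R \<Longrightarrow> e \<otimes> e = e \<Longrightarrow> e \<noteq> \<zero> \<Longrightarrow> Suc n \<le> card {x \<in> carrier R. e \<otimes> x = x}"
    and card: "card (carrier R) = Suc n ^ a"
  shows "card {f \<in> carrier R. f \<otimes> f = f} = 2 ^ a"
proof -
  have 1: "{x \<in> carrier R. \<one> \<otimes> x = x} = carrier R"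
    "{f \<in> carrier R. f \<otimes> f = f \<and> \<one> \<otimes> f = f} = {f \<in> carrier R. f \<otimes> f = f}" by auto
  have "\<exists>b. card {x \<in> carrier R. \<one> \<otimes> x = x} = Suc n ^ b \<and>
      card {f \<in> carrier R. f \<otimes> f = f \<and> \<one> \<otimes> f = f} = 2 ^ b"
    by (rule card_idempotents_below) (fact fin n pow large one_closed | simp)+
  then obtain b where b: "card (carrier R) = Suc n ^ b" "card {f \<in> carrier R. f \<otimes> f = f} = 2 ^ b"
    unfolding 1 by blast
  then have "a = b" using card n power_inject_exp[of "Suc n" a b] by simp
  then show ?thesis using b by simp
qed

section \<open>Cyclotomic classes\<close>

lemma (in group) pow_cong_order:
  assumes "x \<in> carrier G" and "[i = j] (mod order G)"
  shows "x [^] i = x [^] (j :: nat)"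
proof -
  have "x [^] i = x [^] (i mod order G)" for i :: nat
  proof -
    have "x [^] i = x [^] (order G * (i div order G) + i mod order G)" by simp
    also have "\<dots> = (x [^] order G) [^] (i div order G) \<otimes> x [^] (i mod order G)"
      using assms(1) by (simp only: nat_pow_mult[symmetric] nat_pow_pow)
    finally show ?thesis using assms(1) by (simp add: pow_order_eq_1)
  qed
  then show ?thesis using assms(2) by (metis cong_def)
qed

text \<open>Raising to an inverse of \<open>n\<close> modulo the group order undoes the power
  map.\<close>

lemma (in group) inj_on_pow_coprime:
  assumes "coprime n (order G)"
  shows "inj_on (\<lambda>x. x [^] n) (carrier G)"
proof (rule inj_onI)
  fix x y assume x: "x \<in> carrier G" and y: "y \<in> carrier G" and eq: "x [^] n = y [^] n"
  obtain t where t: "[n * t = 1] (mod order G)"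
    using cong_solve_coprime_nat[OF assms] by auto
  have "z = (z [^] n) [^] t" if "z \<in> carrier G" for z
    using pow_cong_order[OF that t] that by (simp add: nat_pow_pow)
  then show "x = y" using x y eq by metis
qed

lemma (in group) cyclotomic_class_self:
  "x \<in> carrier G \<Longrightarrow> x \<in> cyclotomic_class G n x"
  unfolding cyclotomic_class_def by (auto intro!: exI[of _ 0])

lemma (in group) cyclotomic_class_subset:
  "x \<in> carrier G \<Longrightarrow> cyclotomic_class G n x \<subseteq> carrier G"
  unfolding cyclotomic_class_def by auto

lemma (in group) cyclotomic_class_pow:
  assumes n: "coprime n (order G)" and x: "x \<in> carrier G"
  shows "cyclotomic_class G n (x [^] n) = cyclotomic_class G n x"
proof
  have "(x [^] n) [^] (n ^ i) = x [^] (n ^ Suc i)" for i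
    using x by (simp add: nat_pow_pow)
  then show "cyclotomic_class G n (x [^] n) \<subseteq> cyclotomic_class G n x"
    unfolding cyclotomic_class_def by blast
next
  show "cyclotomic_class G n x \<subseteq> cyclotomic_class G n (x [^] n)"
  proof
    fix y assume "y \<in> cyclotomic_class G n x"
    then obtain i where y: "y = x [^] (n ^ i)" unfolding cyclotomic_class_def by auto
    \<comment> \<open>Multiplying the exponent by \<open>n ^ N\<close>, which is 1 modulo the group
      order, changes nothing; as \<open>N > 0\<close>, one factor \<open>n\<close> can be split off
      and moved into the base.\<close>
    define N where "N = Pocklington.ord (order G) n"
    have "N > 0" using n by (simp add: N_def coprime_commute)
    then obtain N' where N': "N = Suc N'" using gr0_implies_Suc by blast
    have "[n ^ i * n ^ N = n ^ i * 1] (mod order G)"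
      unfolding N_def by (intro cong_mult cong_refl Pocklington.ord)
    then have "y = x [^] (n ^ i * n ^ N)" unfolding y using pow_cong_order x by (metis mult_1_right)
    also have "\<dots> = (x [^] n) [^] (n ^ (i + N'))"
      using x by (simp add: nat_pow_pow N' power_add mult_ac)
    finally show "y \<in> cyclotomic_class G n (x [^] n)"
      unfolding cyclotomic_class_def by blast
  qed
qed

text \<open>Consequently classes that meet coincide, so the classes partition the group.\<close>

lemma (in group) cyclotomic_class_eq:
  assumes n: "coprime n (order G)" and x: "x \<in> carrier G" and y: "y \<in> cyclotomic_class G n x"
  shows "cyclotomic_class G n y = cyclotomic_class G n x"
proof -
  obtain i where i: "y = x [^] (n ^ i)" using y unfolding cyclotomic_class_def by auto
  have "cyclotomic_class G n (x [^] (n ^ i)) = cyclotomic_class G n x"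
  proof (induction i)
    case (Suc i)
    have "x [^] (n ^ Suc i) = (x [^] (n ^ i)) [^] n" using x by (simp add: nat_pow_pow mult.commute)
    then show ?case using Suc cyclotomic_class_pow[OF n] x by simp
  qed (use x in simp)
  then show ?thesis using i by simp
qed

lemma (in group) pow_eq_iff_cong:
  assumes "x \<in> carrier G"
  shows "x [^] (i::nat) = x [^] j \<longleftrightarrow> [i = j] (mod ord x)"
proof -
  have "x [^] i = x [^] j \<longleftrightarrow> int (ord x) dvd int j - int i"
    using int_pow_eq[OF assms, of "int i" "int j"] by (simp add: int_pow_int)
  then show ?thesis
    by (metis cong_iff_dvd_diff cong_int_iff cong_sym_eq)
qed

text \<open>The element \<open>a [^] (n ^ i)\<close> depends exactly on \<open>n ^ i\<close> modulo
  the order of \<open>a\<close>, hence on \<open>i\<close> modulo the multiplicative order of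
  \<open>n\<close>. Here \<open>ord\<close> is the order of a group element, while
  \<open>Pocklington.ord\<close> is the multiplicative order with the modulus as first
  argument.\<close>

lemma (in group) card_cyclotomic_class:
  assumes a: "a \<in> carrier G" and n: "coprime n (ord a)"
  shows "card (cyclotomic_class G n a) = Pocklington.ord (ord a) n"
proof -
  let ?D = "Pocklington.ord (ord a) n"
  have eq: "a [^] (n ^ i) = a [^] (n ^ j) \<longleftrightarrow> [i = j] (mod ?D)" for i j
    using pow_eq_iff_cong[OF a] order_divides_expdiff[of "ord a" n] n by (simp add: coprime_commute)
  have D: "?D > 0" using n by (simp add: coprime_commute)
  have "cyclotomic_class G n a = (\<lambda>i. a [^] (n ^ i)) ` {..<?D}"
  proof (intro subset_antisym subsetI)
    fix x assume "x \<in> cyclotomic_class G n a"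
    then obtain i where "x = a [^] (n ^ i)" unfolding cyclotomic_class_def by auto
    then have "x = a [^] (n ^ (i mod ?D))" using eq[of i "i mod ?D"] by (simp add: cong_def)
    then show "x \<in> (\<lambda>i. a [^] (n ^ i)) ` {..<?D}" using D by auto
  qed (auto simp: cyclotomic_class_def)
  moreover have "inj_on (\<lambda>i. a [^] (n ^ i)) {..<?D}"
    using eq by (auto simp: inj_on_def cong_def)
  ultimately show ?thesis by (simp add: card_image)
qed

text \<open>If every element is weighted by the reciprocal of the size of its class, each class has
  total weight 1.\<close>

lemma (in group) card_cyclotomic_classes:
  assumes fin: "finite (carrier G)" and n: "coprime n (order G)"
  shows "real (card (cyclotomic_class G n ` carrier G))
    = (\<Sum>a\<in>carrier G. 1 / real (Pocklington.ord (ord a) n))"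
proof -
  let ?c = "cyclotomic_class G n"
  have cop: "coprime n (ord a)" if "a \<in> carrier G" for a
    using ord_dvd_group_order[OF that] n by (meson coprime_divisors dvd_refl)
  have "(\<Sum>a\<in>carrier G. 1 / real (Pocklington.ord (ord a) n)) = (\<Sum>a\<in>carrier G. 1 / real (card (?c a)))"
    using cop by (simp add: card_cyclotomic_class)
  also have "\<dots> = (\<Sum>X\<in>?c ` carrier G. \<Sum>a\<in>{a\<in>carrier G. ?c a = X}. 1 / real (card (?c a)))"
    by (rule sum.image_gen[OF fin])
  also have "\<dots> = (\<Sum>X\<in>?c ` carrier G. 1)"
  proof (rule sum.cong[OF refl])
    fix X assume "X \<in> ?c ` carrier G"
    then obtain a where a: "a \<in> carrier G" "X = ?c a" by blast
    have "{b \<in> carrier G. ?c b = X} = X"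
      using a cyclotomic_class_self cyclotomic_class_subset cyclotomic_class_eq[OF n a(1)] by blast
    moreover from this have "?c b = X" if "b \<in> X" for b using that by blast
    moreover have "card X > 0"
      using cop[OF a(1)] by (simp add: a card_cyclotomic_class coprime_commute)
    ultimately show "(\<Sum>a\<in>{a\<in>carrier G. ?c a = X}. 1 / real (card (?c a))) = 1"
      by simp
  qed
  finally show ?thesis by simp
qed

text \<open>Elements of order exactly \<open>q ^ i\<close> are those killed by \<open>q ^ i\<close>
  but not by \<open>q ^ (i - 1)\<close>, so it suffices to count torsion. The induction climbs the
  chain of torsion sets \<open>T j\<close>.\<close>

lemma (in group) sum_by_order_prime_power:
  fixes f :: "nat \<Rightarrow> real"
  assumes q: "prime (q::nat)" and fin: "finite (carrier G)" 
    and card: "\<And>i. i \<le> k \<Longrightarrow> card {a \<in> carrier G. a [^] (q ^ i) = \<one>} = N i"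
    and order: "\<And>a. a \<in> carrier G \<Longrightarrow> a [^] (q ^ k) = \<one>"
  shows "(\<Sum>a\<in>carrier G. f (ord a)) = f 1 + (\<Sum>i=1..k. (real (N i) - real (N (i - 1))) * f (q ^ i))"
proof -
  define T where "T i = {a \<in> carrier G. a [^] (q ^ i) = \<one>}" for i
  have finT: "finite (T i)" for i using fin by (simp add: T_def)
  have Tord: "a \<in> T i \<longleftrightarrow> a \<in> carrier G \<and> ord a dvd q ^ i" for a i
    by (auto simp: T_def pow_eq_id)
  have "(\<Sum>a\<in>T j. f (ord a)) = f 1 + (\<Sum>i=1..j. (real (N i) - real (N (i - 1))) * f (q ^ i))"
    if "j \<le> k" for j
    using that
  proof (induction j)
    case 0
    have "T 0 = {\<one>}" by (auto simp: T_def)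
    then show ?case by simp
  next
    case (Suc j)
    have sub: "T j \<subseteq> T (Suc j)" by (auto simp: Tord)
    have "f (ord a) = f (q ^ Suc j)" if "a \<in> T (Suc j) - T j" for a
    proof -
      have dvd: "ord a dvd q ^ Suc j" using that Tord by blast
      obtain i where i: "i \<le> Suc j" "ord a = q ^ i"
        using divides_primepow_nat[OF q] dvd by blast
      have "\<not> i \<le> j" using that i le_imp_power_dvd[of i j q] by (auto simp: Tord)
      then have "i = Suc j" using i by simp
      then show ?thesis using i by simp
    qed
    then have "(\<Sum>a\<in>T (Suc j) - T j. f (ord a)) = real (card (T (Suc j) - T j)) * f (q ^ Suc j)"
      by simp
    also have "real (card (T (Suc j) - T j)) = real (N (Suc j)) - real (N j)"
      using card[of j] card[of "Suc j"] Suc.prems card_mono[OF finT sub]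
      unfolding card_Diff_subset[OF finT sub] T_def[symmetric] by (simp add: of_nat_diff)
    finally have "(\<Sum>a\<in>T (Suc j) - T j. f (ord a)) = (real (N (Suc j)) - real (N j)) * f (q ^ Suc j)" .
    then show ?case
      using sum.subset_diff[OF sub finT, of "\<lambda>a. f (ord a)"] Suc by simp
  qed
  moreover have "T k = carrier G" using order by (auto simp: T_def)
  ultimately show ?thesis by (metis order_refl)
qed

lemma (in group) type_I_Un_type_II:
  "type_I_classes G n \<union> type_II_classes G n = cyclotomic_class G n ` carrier G"
  by (auto simp: type_I_classes_def type_II_classes_def)

text \<open>Additively, \<open>-a = n^j a\<close> means \<open>(n^j + 1) a = 0\<close>. So the type
  of a class depends only on the order of \<open>a\<close>: it asks whether -1 is a power of
  \<open>n\<close> modulo that order.\<close>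

lemma (in group) inv_mem_cyclotomic_class_iff:
  assumes "a \<in> carrier G"
  shows "inv a \<in> cyclotomic_class G n a \<longleftrightarrow> (\<exists>j. ord a dvd n ^ j + 1)"
proof -
  have "inv a = a [^] (n ^ j) \<longleftrightarrow> ord a dvd n ^ j + 1" for j
  proof -
    have "inv a = a [^] (n ^ j) \<longleftrightarrow> a [^] (n ^ j) \<otimes> a = \<one>"
      using assms by (metis inv_equality l_inv nat_pow_closed)
    also have "a [^] (n ^ j) \<otimes> a = a [^] (n ^ j + 1)" using assms by simp
    finally show ?thesis unfolding pow_eq_id[OF assms] .
  qed
  then show ?thesis unfolding cyclotomic_class_def by blast
qed

section \<open>The group algebra\<close>

text \<open>Lagrange in the additive group makes \<open>p ^ n\<close> times \<open>\<one>\<close>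
  vanish. This element is the \<open>n\<close>-th power of \<open>p\<close> times
  \<open>\<one>\<close>, and a field has no nonzero nilpotents.\<close>

lemma (in field) card_carrier_char:
  assumes p: "prime (p::nat)" and card: "order R = p ^ n"
  shows "[p] \<cdot> \<one> = \<zero>"
proof -
  have pow: "[(p ^ i)] \<cdot> \<one> = ([p] \<cdot> \<one>) [^] i" for i
  proof (induction i)
    case (Suc i)
    have "[(p ^ Suc i)] \<cdot> \<one> = [p] \<cdot> ([(p ^ i)] \<cdot> \<one>)" 
      by (simp add: add.nat_pow_pow mult.commute)
    also have "\<dots> = ([p] \<cdot> \<one>) [^] i \<otimes> ([p] \<cdot> \<one>)"
      unfolding Suc by (simp add: add_pow_rdistr)
    finally show ?case by simp
  qed simp
  have "order (add_monoid R) = p ^ n" using card by (simp add: order_def)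
  then have "[(p ^ n)] \<cdot> \<one> = \<zero>" using add.pow_order_eq_1[of \<one>] by simp
  then have *: "([p] \<cdot> \<one>) [^] n = \<zero>" using pow by simp
  show ?thesis
  proof (rule ccontr)
    assume "[p] \<cdot> \<one> \<noteq> \<zero>"
    moreover have "[p] \<cdot> \<one> \<in> carrier R" by simp
    ultimately have "([p] \<cdot> \<one>) [^] n \<noteq> \<zero>" by (induction n) (auto simp: integral_iff)
    then show False using * by simp
  qed
qed

text \<open>For nonzero \<open>c\<close> this is Lagrange in the multiplicative group, which has one
  element less than the field.\<close>

lemma (in field) pow_order_eq_self:
  assumes fin: "finite (carrier R)" and c: "c \<in> carrier R"
  shows "c [^] order R = c"
proof -
  have o: "order R > 0" using fin c by (auto simp: order_gt_0_iff_finite)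
  then obtain n where n: "order R = Suc n" using gr0_implies_Suc by blast
  show ?thesis
  proof (cases "c = \<zero>")
    case True
    then show ?thesis using n by simp
  next
    case False
    have "c [^]\<^bsub>mult_of R\<^esub> order (mult_of R) = \<one>\<^bsub>mult_of R\<^esub>"
      using False c by (intro group.pow_order_eq_1 field_mult_group) simp
    then have "c [^] n = \<one>" using n by (simp add: nat_pow_mult_of order_mult_of[OF fin])
    then show ?thesis using n c by simp
  qed
qed

section \<open>The group algebra of an abelian group whose order is prime to
  \<open>p\<close>\<close>

locale coprime_group_algebra =
  F: field F + G: comm_group G for F :: "('f, 'm) ring_scheme" and G :: "('g, 'n) monoid_scheme" +
  fixes p \<nu> :: nat
  assumes prime_p: "prime p" and order_F: "order F = p ^ \<nu>" and coprime_p: "coprime p (order G)"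
begin

abbreviation "A \<equiv> group_algebra F G"
abbreviation "m \<equiv> p ^ \<nu>"

lemma finite_F: "finite (carrier F)"
  using order_F prime_gt_0_nat[OF prime_p] by (metis F.order_gt_0_iff_finite zero_less_power)

lemma finite_G: "finite (carrier G)"
proof (rule ccontr)
  assume "infinite (carrier G)"
  \<comment> \<open>An infinite group has the default order 0, which is coprime to no prime.\<close>
  then have "order G = 0" by (simp add: order_def)
  then show False using coprime_p prime_p by simp
qed

lemma coprime_m: "coprime m (order G)" using coprime_p by simp

lemma apply_closed [simp]: "u \<in> carrier A \<Longrightarrow> g \<in> carrier G \<Longrightarrow> u g \<in> carrier F"
  by (auto simp: group_algebra_def)

lemma eqI:
  "u \<in> carrier A \<Longrightarrow> v \<in> carrier A \<Longrightarrow> (\<And>g. g \<in> carrier G \<Longrightarrow> u g = v g) \<Longrightarrow> u = v"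
  by (auto simp: group_algebra_def intro: PiE_ext)

lemma restrict_closed: "(\<And>g. g \<in> carrier G \<Longrightarrow> f g \<in> carrier F) \<Longrightarrow> (\<lambda>g\<in>carrier G. f g) \<in> carrier A"
  by (auto simp: group_algebra_def)

lemma mult_apply:
  "g \<in> carrier G \<Longrightarrow> (u \<otimes>\<^bsub>A\<^esub> v) g = (\<Oplus>\<^bsub>F\<^esub>h\<in>carrier G. u h \<otimes>\<^bsub>F\<^esub> v (inv\<^bsub>G\<^esub> h \<otimes>\<^bsub>G\<^esub> g))"
  by (simp add: group_algebra_def)

lemma add_apply: "g \<in> carrier G \<Longrightarrow> (u \<oplus>\<^bsub>A\<^esub> v) g = u g \<oplus>\<^bsub>F\<^esub> v g"
  by (simp add: group_algebra_def)

lemma zero_apply: "g \<in> carrier G \<Longrightarrow> \<zero>\<^bsub>A\<^esub> g = \<zero>\<^bsub>F\<^esub>"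
  by (simp add: group_algebra_def)

lemma one_apply: "g \<in> carrier G \<Longrightarrow> \<one>\<^bsub>A\<^esub> g = (if g = \<one>\<^bsub>G\<^esub> then \<one>\<^bsub>F\<^esub> else \<zero>\<^bsub>F\<^esub>)"
  by (simp add: group_algebra_def)

lemma inv_reflect:
  "g \<in> carrier G \<Longrightarrow> h \<in> carrier G \<Longrightarrow> inv\<^bsub>G\<^esub> (g \<otimes>\<^bsub>G\<^esub> inv\<^bsub>G\<^esub> h) = inv\<^bsub>G\<^esub> g \<otimes>\<^bsub>G\<^esub> h"
  by (simp add: G.inv_mult_group G.m_comm)

text \<open>By commutativity the substitution is an involution of the group. In a convolution at
  \<open>g\<close> it moves the simple argument \<open>h\<close> from the first factor to the
  second.\<close>

lemma finsum_reflect: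
  assumes g: "g \<in> carrier G" and f: "\<And>h. h \<in> carrier G \<Longrightarrow> f h \<in> carrier F"
  shows "(\<Oplus>\<^bsub>F\<^esub>h\<in>carrier G. f h) = (\<Oplus>\<^bsub>F\<^esub>h\<in>carrier G. f (g \<otimes>\<^bsub>G\<^esub> inv\<^bsub>G\<^esub> h))"
proof -
  have b: "bij_betw (\<lambda>h. g \<otimes>\<^bsub>G\<^esub> inv\<^bsub>G\<^esub> h) (carrier G) (carrier G)"
    by (rule bij_betw_byWitness[where f' = "\<lambda>h. g \<otimes>\<^bsub>G\<^esub> inv\<^bsub>G\<^esub> h"])
       (use g in \<open>auto simp: inv_reflect simp flip: G.m_assoc\<close>)
  have "(\<Oplus>\<^bsub>F\<^esub>h\<in>(\<lambda>h. g \<otimes>\<^bsub>G\<^esub> inv\<^bsub>G\<^esub> h) ` carrier G. f h) = (\<Oplus>\<^bsub>F\<^esub>h\<in>carrier G. f (g \<otimes>\<^bsub>G\<^esub> inv\<^bsub>G\<^esub> h))"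
    by (rule F.finsum_reindex) (use b g f in \<open>auto simp: bij_betw_def\<close>)
  then show ?thesis using b by (simp add: bij_betw_def)
qed

lemma conj_cancel: "g \<in> carrier G \<Longrightarrow> h \<in> carrier G \<Longrightarrow> inv\<^bsub>G\<^esub> g \<otimes>\<^bsub>G\<^esub> h \<otimes>\<^bsub>G\<^esub> g = h"
  by (simp add: G.m_comm[of "inv\<^bsub>G\<^esub> g"] G.m_assoc)

sublocale A: cring A
proof -
  interpret ring A
    using F.ring_axioms G.group_axioms finite_G by (rule ring_group_algebra)
  show "cring A"
  proof (rule cring.intro[OF ring_axioms comm_monoid.intro[OF monoid_axioms]], unfold_locales)
    fix u v assume u: "u \<in> carrier A" and v: "v \<in> carrier A"
    show "u \<otimes>\<^bsub>A\<^esub> v = v \<otimes>\<^bsub>A\<^esub> u"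
    proof (rule eqI)
      fix g assume g: "g \<in> carrier G"
      have "(u \<otimes>\<^bsub>A\<^esub> v) g = (\<Oplus>\<^bsub>F\<^esub>h\<in>carrier G. u (g \<otimes>\<^bsub>G\<^esub> inv\<^bsub>G\<^esub> h) \<otimes>\<^bsub>F\<^esub> v (inv\<^bsub>G\<^esub> (g \<otimes>\<^bsub>G\<^esub> inv\<^bsub>G\<^esub> h) \<otimes>\<^bsub>G\<^esub> g))"
        unfolding mult_apply[OF g] by (rule finsum_reflect) (use g u v in auto)
      also have "\<dots> = (v \<otimes>\<^bsub>A\<^esub> u) g"
        unfolding mult_apply[OF g]
      proof (intro F.finsum_cong' refl)
        fix h assume h: "h \<in> carrier G"
        show "u (g \<otimes>\<^bsub>G\<^esub> inv\<^bsub>G\<^esub> h) \<otimes>\<^bsub>F\<^esub> v (inv\<^bsub>G\<^esub> (g \<otimes>\<^bsub>G\<^esub> inv\<^bsub>G\<^esub> h) \<otimes>\<^bsub>G\<^esub> g)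
            = v h \<otimes>\<^bsub>F\<^esub> u (inv\<^bsub>G\<^esub> h \<otimes>\<^bsub>G\<^esub> g)"
          unfolding inv_reflect[OF g h] conj_cancel[OF g h]
          unfolding G.m_comm[OF g G.inv_closed[OF h]]
          by (rule F.m_comm) (use g h u v in auto)
      qed (use g u v in auto)
      finally show "(u \<otimes>\<^bsub>A\<^esub> v) g = (v \<otimes>\<^bsub>A\<^esub> u) g" .
    qed (use u v in auto)
  qed
qed

lemma finsum_apply:
  assumes "finite S" "\<And>s. s \<in> S \<Longrightarrow> f s \<in> carrier A" "g \<in> carrier G"
  shows "(\<Oplus>\<^bsub>A\<^esub>s\<in>S. f s) g = (\<Oplus>\<^bsub>F\<^esub>s\<in>S. f s g)"
  using assms(1,2)
proof (induction S rule: finite_induct)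
  case empty
  then show ?case using assms(3) by (simp add: zero_apply)
next
  case (insert a S)
  have "(\<Oplus>\<^bsub>A\<^esub>s\<in>insert a S. f s) = f a \<oplus>\<^bsub>A\<^esub> (\<Oplus>\<^bsub>A\<^esub>s\<in>S. f s)"
    using insert by (intro A.finsum_insert) auto
  moreover have "(\<Oplus>\<^bsub>F\<^esub>s\<in>insert a S. f s g) = f a g \<oplus>\<^bsub>F\<^esub> (\<Oplus>\<^bsub>F\<^esub>s\<in>S. f s g)"
    using insert assms(3) by (intro F.finsum_insert) auto
  ultimately show ?case using insert assms(3) by (simp add: add_apply)
qed

text \<open>The monomial \<open>c Y^g\<close>.\<close>

definition single :: "'g \<Rightarrow> 'f \<Rightarrow> 'g \<Rightarrow> 'f" where
  "single g c = (\<lambda>h\<in>carrier G. if h = g then c else \<zero>\<^bsub>F\<^esub>)"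

lemma single_closed [simp]: "c \<in> carrier F \<Longrightarrow> single g c \<in> carrier A"
  unfolding single_def by (rule restrict_closed) auto

lemma single_apply: "h \<in> carrier G \<Longrightarrow> single g c h = (if h = g then c else \<zero>\<^bsub>F\<^esub>)"
  by (simp add: single_def)

lemma single_mult_apply:
  assumes g: "g \<in> carrier G" and c: "c \<in> carrier F" and v: "v \<in> carrier A" and h: "h \<in> carrier G"
  shows "(single g c \<otimes>\<^bsub>A\<^esub> v) h = c \<otimes>\<^bsub>F\<^esub> v (inv\<^bsub>G\<^esub> g \<otimes>\<^bsub>G\<^esub> h)"
proof -
  have "(single g c \<otimes>\<^bsub>A\<^esub> v) h
      = (\<Oplus>\<^bsub>F\<^esub>l\<in>carrier G. if g = l then c \<otimes>\<^bsub>F\<^esub> v (inv\<^bsub>G\<^esub> l \<otimes>\<^bsub>G\<^esub> h) else \<zero>\<^bsub>F\<^esub>)"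
    unfolding mult_apply[OF h]
    by (intro F.finsum_cong' refl) (use g c v h in \<open>auto simp: single_apply\<close>)
  also have "\<dots> = c \<otimes>\<^bsub>F\<^esub> v (inv\<^bsub>G\<^esub> g \<otimes>\<^bsub>G\<^esub> h)"
    by (rule F.finsum_singleton) (use g c v h finite_G in auto)
  finally show ?thesis .
qed

lemma single_mult:
  assumes "g \<in> carrier G" "h \<in> carrier G" "c \<in> carrier F" "d \<in> carrier F"
  shows "single g c \<otimes>\<^bsub>A\<^esub> single h d = single (g \<otimes>\<^bsub>G\<^esub> h) (c \<otimes>\<^bsub>F\<^esub> d)"
proof (rule eqI)
  fix x assume x: "x \<in> carrier G"
  have "inv\<^bsub>G\<^esub> g \<otimes>\<^bsub>G\<^esub> x = h \<longleftrightarrow> x = g \<otimes>\<^bsub>G\<^esub> h"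
    using assms x by (metis G.inv_solve_left)
  then show "(single g c \<otimes>\<^bsub>A\<^esub> single h d) x = single (g \<otimes>\<^bsub>G\<^esub> h) (c \<otimes>\<^bsub>F\<^esub> d) x"
    using assms x by (simp add: single_mult_apply single_apply)
qed (use assms in auto)

lemma one_eq_single: "\<one>\<^bsub>A\<^esub> = single \<one>\<^bsub>G\<^esub> \<one>\<^bsub>F\<^esub>"
  by (rule eqI) (auto simp: one_apply single_apply)

lemma single_pow:
  assumes "g \<in> carrier G" "c \<in> carrier F"
  shows "single g c [^]\<^bsub>A\<^esub> (n::nat) = single (g [^]\<^bsub>G\<^esub> n) (c [^]\<^bsub>F\<^esub> n)"
  by (induction n) (use assms in \<open>auto simp: one_eq_single single_mult\<close>)

lemma eq_finsum_single:
  assumes u: "u \<in> carrier A"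
  shows "u = (\<Oplus>\<^bsub>A\<^esub>g\<in>carrier G. single g (u g))"
proof (rule eqI)
  fix h assume h: "h \<in> carrier G"
  have "(\<Oplus>\<^bsub>A\<^esub>g\<in>carrier G. single g (u g)) h = (\<Oplus>\<^bsub>F\<^esub>g\<in>carrier G. if h = g then u g else \<zero>\<^bsub>F\<^esub>)"
    using finite_G u h by (subst finsum_apply) (auto simp: single_apply)
  also have "\<dots> = u h"
    by (rule F.finsum_singleton) (use h u finite_G in auto)
  finally show "u h = (\<Oplus>\<^bsub>A\<^esub>g\<in>carrier G. single g (u g)) h" by simp
qed (use u in \<open>auto intro!: A.finsum_closed\<close>)

lemma add_pow_apply: "u \<in> carrier A \<Longrightarrow> g \<in> carrier G \<Longrightarrow> ([(n::nat)] \<cdot>\<^bsub>A\<^esub> u) g = [n] \<cdot>\<^bsub>F\<^esub> u g"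
  by (induction n) (auto simp: zero_apply add_apply)

section \<open>The Frobenius map on the group algebra\<close>

lemma char_A: "[p] \<cdot>\<^bsub>A\<^esub> \<one>\<^bsub>A\<^esub> = \<zero>\<^bsub>A\<^esub>"
proof (rule eqI)
  fix g assume "g \<in> carrier G"
  then show "([p] \<cdot>\<^bsub>A\<^esub> \<one>\<^bsub>A\<^esub>) g = \<zero>\<^bsub>A\<^esub> g"
    by (simp add: add_pow_apply one_apply zero_apply F.card_carrier_char[OF prime_p order_F])
qed auto

lemma pow_m_pow_F: "c \<in> carrier F \<Longrightarrow> c [^]\<^bsub>F\<^esub> (m ^ n) = c"
proof (induction n)
  case (Suc n)
  have "c [^]\<^bsub>F\<^esub> (m ^ Suc n) = (c [^]\<^bsub>F\<^esub> (m ^ n)) [^]\<^bsub>F\<^esub> m"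
    using Suc.prems by (simp add: F.nat_pow_pow mult.commute)
  then show ?case
    unfolding Suc.IH[OF Suc.prems] using F.pow_order_eq_self[OF finite_F Suc.prems] order_F by simp
qed simp

text \<open>The exponent is a power of \<open>p\<close>, so the power of a sum of monomials is the
  sum of their powers. Coefficients in \<open>F\<close> are fixed, and injectivity of the power map
  on the group keeps distinct monomials apart.\<close>

lemma frobenius_apply:
  assumes u: "u \<in> carrier A" and h: "h \<in> carrier G"
  shows "(u [^]\<^bsub>A\<^esub> (m ^ n)) (h [^]\<^bsub>G\<^esub> (m ^ n)) = u h"
proof -
  let ?M = "m ^ n"
  have M: "?M = p ^ (\<nu> * n)" by (simp add: power_mult)
  have inj: "h [^]\<^bsub>G\<^esub> ?M = g [^]\<^bsub>G\<^esub> ?M \<longleftrightarrow> g = h" if "g \<in> carrier G" for g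
    using G.inj_on_pow_coprime[of ?M] coprime_m that h by (auto simp: inj_on_def)
  have "u [^]\<^bsub>A\<^esub> ?M = (\<Oplus>\<^bsub>A\<^esub>g\<in>carrier G. single g (u g) [^]\<^bsub>A\<^esub> ?M)"
    unfolding M using u
    by (subst eq_finsum_single[OF u], intro A.frobenius_power_finsum[OF prime_p char_A finite_G]) auto
  then have "(u [^]\<^bsub>A\<^esub> ?M) (h [^]\<^bsub>G\<^esub> ?M) = (\<Oplus>\<^bsub>F\<^esub>g\<in>carrier G. (single g (u g) [^]\<^bsub>A\<^esub> ?M) (h [^]\<^bsub>G\<^esub> ?M))"
    using u h finite_G by (simp add: finsum_apply)
  also have "\<dots> = (\<Oplus>\<^bsub>F\<^esub>g\<in>carrier G. if h = g then u g else \<zero>\<^bsub>F\<^esub>)"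
    by (intro F.finsum_cong' refl) (use u h inj in \<open>auto simp: single_pow single_apply pow_m_pow_F\<close>)
  also have "\<dots> = u h"
    by (rule F.finsum_singleton) (use h u finite_G in auto)
  finally show ?thesis .
qed

text \<open>The Frobenius map merely permutes coefficients along \<open>g \<mapsto> m g\<close>. The
  backward direction uses that this map is also onto, by finiteness.\<close>

lemma pow_m_eq_self_iff:
  assumes u: "u \<in> carrier A"
  shows "u [^]\<^bsub>A\<^esub> m = u \<longleftrightarrow> (\<forall>g\<in>carrier G. u (g [^]\<^bsub>G\<^esub> m) = u g)"
proof
  assume "u [^]\<^bsub>A\<^esub> m = u"
  then show "\<forall>g\<in>carrier G. u (g [^]\<^bsub>G\<^esub> m) = u g" using frobenius_apply[OF u, of _ 1] by simp
next
  assume *: "\<forall>g\<in>carrier G. u (g [^]\<^bsub>G\<^esub> m) = u g"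
  have "(\<lambda>g. g [^]\<^bsub>G\<^esub> m) ` carrier G = carrier G"
    using G.inj_on_pow_coprime[OF coprime_m] by (intro endo_inj_surj finite_G) auto
  then have surj: "\<exists>h\<in>carrier G. g = h [^]\<^bsub>G\<^esub> m" if "g \<in> carrier G" for g using that by blast
  show "u [^]\<^bsub>A\<^esub> m = u"
  proof (rule eqI)
    fix g assume "g \<in> carrier G"
    then obtain h where h: "h \<in> carrier G" "g = h [^]\<^bsub>G\<^esub> m" using surj by blast
    then show "(u [^]\<^bsub>A\<^esub> m) g = u g" using frobenius_apply[OF u h(1), of 1] * by simp
  qed (use u in auto)
qed

text \<open>If \<open>m ^ N\<close> is 1 modulo the group order, the \<open>N\<close>-th iterate of
  the Frobenius map leaves every coefficient in place.\<close>

lemma exists_pow_eq_self: "\<exists>n>0. \<forall>u\<in>carrier A. u [^]\<^bsub>A\<^esub> Suc n = u"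
proof -
  define N where "N = Pocklington.ord (order G) m"
  have N: "[m ^ N = 1] (mod order G)" unfolding N_def by (rule Pocklington.ord)
  have N0: "N > 0" using coprime_m by (simp add: N_def coprime_commute)
  \<comment> \<open>A field has at least two elements; this makes \<open>n = m ^ N - 1\<close>
    positive.\<close>
  have "{\<zero>\<^bsub>F\<^esub>, \<one>\<^bsub>F\<^esub>} \<subseteq> carrier F" by simp
  from card_mono[OF finite_F this] have m2: "m \<ge> 2" using order_F by (simp add: order_def)
  then have "m ^ N > 1" using N0 m2 self_le_power[of m N] by linarith
  then obtain n where n: "m ^ N = Suc n" "n > 0" by (metis Suc_lessE One_nat_def)
  have "u [^]\<^bsub>A\<^esub> Suc n = u" if u: "u \<in> carrier A" for u
  proof (rule eqI)
    fix g assume g: "g \<in> carrier G"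
    have "g [^]\<^bsub>G\<^esub> (m ^ N) = g" using G.pow_cong_order[OF g N] g by simp
    then show "(u [^]\<^bsub>A\<^esub> Suc n) g = u g" using frobenius_apply[OF u g, of N] n by simp
  qed (use u in \<open>auto simp del: A.nat_pow_Suc\<close>)
  then show ?thesis using n by blast
qed

section \<open>The involution and the Euclidean dual\<close>

definition star :: "('g \<Rightarrow> 'f) \<Rightarrow> 'g \<Rightarrow> 'f" where
  "star u = (\<lambda>g\<in>carrier G. u (inv\<^bsub>G\<^esub> g))"

lemma star_closed [simp]: "u \<in> carrier A \<Longrightarrow> star u \<in> carrier A"
  unfolding star_def by (rule restrict_closed) auto

lemma star_apply: "g \<in> carrier G \<Longrightarrow> star u g = u (inv\<^bsub>G\<^esub> g)"
  by (simp add: star_def)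

lemma star_star [simp]: "u \<in> carrier A \<Longrightarrow> star (star u) = u"
  by (rule eqI) (auto simp: star_apply)

lemma star_one: "star \<one>\<^bsub>A\<^esub> = \<one>\<^bsub>A\<^esub>"
  by (rule eqI) (auto simp: star_apply one_apply)

lemma star_mult:
  assumes u: "u \<in> carrier A" and v: "v \<in> carrier A"
  shows "star (u \<otimes>\<^bsub>A\<^esub> v) = star u \<otimes>\<^bsub>A\<^esub> star v"
proof (rule eqI)
  fix g assume g: "g \<in> carrier G"
  have "star (u \<otimes>\<^bsub>A\<^esub> v) g = (\<Oplus>\<^bsub>F\<^esub>h\<in>carrier G. u h \<otimes>\<^bsub>F\<^esub> v (inv\<^bsub>G\<^esub> h \<otimes>\<^bsub>G\<^esub> inv\<^bsub>G\<^esub> g))"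
    using g by (simp add: star_apply mult_apply)
  \<comment> \<open>Reflection at the identity substitutes the inverse of \<open>h\<close> for
    \<open>h\<close>.\<close>
  also have "\<dots> = (\<Oplus>\<^bsub>F\<^esub>h\<in>carrier G. u (\<one>\<^bsub>G\<^esub> \<otimes>\<^bsub>G\<^esub> inv\<^bsub>G\<^esub> h) \<otimes>\<^bsub>F\<^esub> v (inv\<^bsub>G\<^esub> (\<one>\<^bsub>G\<^esub> \<otimes>\<^bsub>G\<^esub> inv\<^bsub>G\<^esub> h) \<otimes>\<^bsub>G\<^esub> inv\<^bsub>G\<^esub> g))"
    by (rule finsum_reflect) (use g u v in auto)
  also have "\<dots> = (star u \<otimes>\<^bsub>A\<^esub> star v) g"
    unfolding mult_apply[OF g]
    by (intro F.finsum_cong' refl) (use g u v in \<open>auto simp: star_apply G.inv_mult_group G.m_comm\<close>)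
  finally show "star (u \<otimes>\<^bsub>A\<^esub> v) g = (star u \<otimes>\<^bsub>A\<^esub> star v) g" .
qed (use u v in auto)

text \<open>The coefficients of \<open>u* v\<close> are the inner products of \<open>v\<close> with
  the translates of \<open>u\<close>. This links orthogonality to multiplication.\<close>

lemma star_mult_apply:
  assumes u: "u \<in> carrier A" and v: "v \<in> carrier A" and g: "g \<in> carrier G"
  shows "(star u \<otimes>\<^bsub>A\<^esub> v) g = euclidean_inner F G (single g \<one>\<^bsub>F\<^esub> \<otimes>\<^bsub>A\<^esub> u) v"
proof -
  have "(star u \<otimes>\<^bsub>A\<^esub> v) g = (\<Oplus>\<^bsub>F\<^esub>h\<in>carrier G. star u (g \<otimes>\<^bsub>G\<^esub> inv\<^bsub>G\<^esub> h) \<otimes>\<^bsub>F\<^esub> v (inv\<^bsub>G\<^esub> (g \<otimes>\<^bsub>G\<^esub> inv\<^bsub>G\<^esub> h) \<otimes>\<^bsub>G\<^esub> g))"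
    unfolding mult_apply[OF g] by (rule finsum_reflect) (use g u v in auto)
  also have "\<dots> = euclidean_inner F G (single g \<one>\<^bsub>F\<^esub> \<otimes>\<^bsub>A\<^esub> u) v"
    unfolding euclidean_inner_def
    by (intro F.finsum_cong' refl)
       (use g u v in \<open>auto simp: star_apply conj_cancel inv_reflect single_mult_apply\<close>)
  finally show ?thesis .
qed

text \<open>An ideal contains all translates of \<open>c\<close>, so orthogonality to it kills every
  coefficient of \<open>c* v\<close>; conversely, the coefficient at the identity is the inner
  product itself.\<close>

lemma euclidean_dual_ideal:
  assumes C: "ideal C A"
  shows "euclidean_dual F G C = {v \<in> carrier A. \<forall>c\<in>C. star c \<otimes>\<^bsub>A\<^esub> v = \<zero>\<^bsub>A\<^esub>}"
proof -
  interpret C: ideal C A by fact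
  have sub: "c \<in> carrier A" if "c \<in> C" for c using that by (rule C.a_Hcarr)
  have "(\<forall>c\<in>C. euclidean_inner F G c v = \<zero>\<^bsub>F\<^esub>) \<longleftrightarrow> (\<forall>c\<in>C. star c \<otimes>\<^bsub>A\<^esub> v = \<zero>\<^bsub>A\<^esub>)"
    if v: "v \<in> carrier A" for v
  proof
    assume *: "\<forall>c\<in>C. euclidean_inner F G c v = \<zero>\<^bsub>F\<^esub>"
    show "\<forall>c\<in>C. star c \<otimes>\<^bsub>A\<^esub> v = \<zero>\<^bsub>A\<^esub>"
    proof
      fix c assume c: "c \<in> C"
      show "star c \<otimes>\<^bsub>A\<^esub> v = \<zero>\<^bsub>A\<^esub>"
      proof (rule eqI)
        fix g assume g: "g \<in> carrier G"
        have "single g \<one>\<^bsub>F\<^esub> \<otimes>\<^bsub>A\<^esub> c \<in> C" using c by (simp add: C.I_l_closed)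
        then show "(star c \<otimes>\<^bsub>A\<^esub> v) g = \<zero>\<^bsub>A\<^esub> g"
          using * star_mult_apply[OF sub[OF c] v g] g by (simp add: zero_apply)
      qed (use sub[OF c] v in auto)
    qed
  next
    assume *: "\<forall>c\<in>C. star c \<otimes>\<^bsub>A\<^esub> v = \<zero>\<^bsub>A\<^esub>"
    show "\<forall>c\<in>C. euclidean_inner F G c v = \<zero>\<^bsub>F\<^esub>"
    proof
      fix c assume c: "c \<in> C"
      have "euclidean_inner F G c v = (star c \<otimes>\<^bsub>A\<^esub> v) \<one>\<^bsub>G\<^esub>"
        using star_mult_apply[OF sub[OF c] v, of "\<one>\<^bsub>G\<^esub>"] sub[OF c] by (simp flip: one_eq_single)
      then show "euclidean_inner F G c v = \<zero>\<^bsub>F\<^esub>" using * c by (simp add: zero_apply)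
    qed
  qed
  then show ?thesis unfolding euclidean_dual_def by blast
qed

lemma complementary_dual_iff_star_idempotent:
  assumes C: "ideal C A" and e: "e \<in> C" "e \<otimes>\<^bsub>A\<^esub> e = e" and eC: "\<forall>x\<in>C. e \<otimes>\<^bsub>A\<^esub> x = x"
  shows "euclidean_complementary_dual F G C \<longleftrightarrow> star e = e"
proof -
  interpret C: ideal C A by fact
  have sub: "c \<in> carrier A" if "c \<in> C" for c using that by (rule C.a_Hcarr)
  have ec: "e \<in> carrier A" using e sub by blast
  have dual: "v \<in> euclidean_dual F G C \<longleftrightarrow> v \<in> carrier A \<and> star e \<otimes>\<^bsub>A\<^esub> v = \<zero>\<^bsub>A\<^esub>" for v
  proof -
    have "star c \<otimes>\<^bsub>A\<^esub> v = \<zero>\<^bsub>A\<^esub>" if "star e \<otimes>\<^bsub>A\<^esub> v = \<zero>\<^bsub>A\<^esub>" "v \<in> carrier A" "c \<in> C" for c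
    proof -
      \<comment> \<open>The involution applied to \<open>c = ec\<close>: whatever \<open>e*\<close>
        annihilates is annihilated by all \<open>c*\<close>.\<close>
      have "star c = star c \<otimes>\<^bsub>A\<^esub> star e"
        using eC that(3) sub[OF that(3)] ec by (metis star_mult A.m_comm)
      then have "star c \<otimes>\<^bsub>A\<^esub> v = star c \<otimes>\<^bsub>A\<^esub> (star e \<otimes>\<^bsub>A\<^esub> v)"
        using sub[OF that(3)] ec that(2) by (metis A.m_assoc star_closed)
      then show ?thesis using that sub by simp
    qed
    then show ?thesis unfolding euclidean_dual_ideal[OF C] using e(1) by blast
  qed
  show ?thesis
  proof
    assume "star e = e"
    then have "x = \<zero>\<^bsub>A\<^esub>" if "x \<in> C" "x \<in> euclidean_dual F G C" for x
      using that eC dual by metis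
    moreover have "\<zero>\<^bsub>A\<^esub> \<in> C \<inter> euclidean_dual F G C" using ec by (simp add: dual)
    ultimately show "euclidean_complementary_dual F G C"
      unfolding euclidean_complementary_dual_def by blast
  next
    assume *: "euclidean_complementary_dual F G C"
    define s where "s = star e"
    have sc: "s \<in> carrier A" using ec by (simp add: s_def)
    have ss: "s \<otimes>\<^bsub>A\<^esub> s = s" using ec e(2) by (simp add: s_def flip: star_mult)
    define x where "x = e \<otimes>\<^bsub>A\<^esub> (\<one>\<^bsub>A\<^esub> \<ominus>\<^bsub>A\<^esub> s)"
    have "x \<in> C" unfolding x_def using sc e(1) by (intro C.I_r_closed) auto
    moreover have "s \<otimes>\<^bsub>A\<^esub> x = \<zero>\<^bsub>A\<^esub>"
    proof -
      have "s \<otimes>\<^bsub>A\<^esub> x = e \<otimes>\<^bsub>A\<^esub> (s \<ominus>\<^bsub>A\<^esub> s \<otimes>\<^bsub>A\<^esub> s)"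
        unfolding x_def using ec sc by algebra
      then show ?thesis unfolding ss using ec sc by algebra
    qed
    ultimately have "x \<in> C \<inter> euclidean_dual F G C" using sub by (simp add: dual s_def)
    then have "x = \<zero>\<^bsub>A\<^esub>" using * unfolding euclidean_complementary_dual_def by blast
    moreover have "x \<oplus>\<^bsub>A\<^esub> e \<otimes>\<^bsub>A\<^esub> s = e"
      unfolding x_def using ec sc by algebra
    ultimately have es: "e \<otimes>\<^bsub>A\<^esub> s = e" using ec sc by simp
    have "s = star (e \<otimes>\<^bsub>A\<^esub> s)" by (simp only: es) (simp add: s_def)
    also have "\<dots> = s \<otimes>\<^bsub>A\<^esub> e" using star_mult[OF ec sc] ec by (simp add: s_def)
    also have "\<dots> = e" using es A.m_comm[OF ec sc] by simp
    finally show "star e = e" by (simp add: s_def)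
  qed
qed

text \<open>For idempotent \<open>e\<close> this set is the principal ideal generated by
  \<open>e\<close>.\<close>

lemma ideal_fixed_by_idempotent:
  assumes e: "e \<in> carrier A"
  shows "ideal {x \<in> carrier A. e \<otimes>\<^bsub>A\<^esub> x = x} A"
proof (rule idealI[OF A.ring_axioms])
  show "subgroup {x \<in> carrier A. e \<otimes>\<^bsub>A\<^esub> x = x} (add_monoid A)"
    by (rule A.add.subgroupI) (use e in \<open>auto simp: A.r_distr A.r_minus intro!: exI[of _ "\<zero>\<^bsub>A\<^esub>"] simp flip: a_inv_def\<close>)
  fix a x assume a: "a \<in> {x \<in> carrier A. e \<otimes>\<^bsub>A\<^esub> x = x}" and x: "x \<in> carrier A"
  show "a \<otimes>\<^bsub>A\<^esub> x \<in> {x \<in> carrier A. e \<otimes>\<^bsub>A\<^esub> x = x}"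
    using a x e by (simp flip: A.m_assoc)
  show "x \<otimes>\<^bsub>A\<^esub> a \<in> {x \<in> carrier A. e \<otimes>\<^bsub>A\<^esub> x = x}"
    using a x e A.m_lcomm[of e x a] by simp
qed

text \<open>Each ideal has an idempotent acting on it as identity. Two such idempotents
  \<open>e\<close> and \<open>f\<close> of one ideal agree, because
  \<open>e = fe = ef = f\<close>.\<close>

lemma card_complementary_dual:
  "card {C. abelian_code F G C \<and> euclidean_complementary_dual F G C}
    = card {e \<in> carrier A. e \<otimes>\<^bsub>A\<^esub> e = e \<and> star e = e}"
proof -
  obtain n where n: "n > 0" "\<And>u. u \<in> carrier A \<Longrightarrow> u [^]\<^bsub>A\<^esub> Suc n = u"
    using exists_pow_eq_self by blast
  have finA: "finite (carrier A)"
    using finite_F finite_G by (auto simp: group_algebra_def intro: finite_PiE)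
  define \<Phi> where "\<Phi> e = {x \<in> carrier A. e \<otimes>\<^bsub>A\<^esub> x = x}" for e
  let ?E = "{e \<in> carrier A. e \<otimes>\<^bsub>A\<^esub> e = e \<and> star e = e}"
  let ?L = "{C. abelian_code F G C \<and> euclidean_complementary_dual F G C}"
  have "inj_on \<Phi> ?E"
  proof (rule inj_onI)
    fix e f assume e: "e \<in> ?E" and f: "f \<in> ?E" and eq: "\<Phi> e = \<Phi> f"
    have "e \<in> \<Phi> f" "f \<in> \<Phi> e" using e f eq by (auto simp: \<Phi>_def)
    then have "f \<otimes>\<^bsub>A\<^esub> e = e" "e \<otimes>\<^bsub>A\<^esub> f = f" by (auto simp: \<Phi>_def)
    then show "e = f" using e f A.m_comm by auto
  qed
  moreover have "\<Phi> ` ?E = ?L"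
  proof (intro subset_antisym subsetI)
    fix C assume "C \<in> \<Phi> ` ?E"
    then obtain e where e: "e \<in> ?E" and C: "C = \<Phi> e" by blast
    have "ideal C A" unfolding C \<Phi>_def using e by (intro ideal_fixed_by_idempotent) auto
    moreover have "e \<in> C" "\<forall>x\<in>C. e \<otimes>\<^bsub>A\<^esub> x = x" using e by (auto simp: C \<Phi>_def)
    ultimately show "C \<in> ?L"
      using complementary_dual_iff_star_idempotent[of C e] e unfolding abelian_code_def by blast
  next
    fix C assume C: "C \<in> ?L"
    then have I: "ideal C A" by (simp add: abelian_code_def)
    interpret C: ideal C A by fact
    from A.ideal_generated_by_idempotent[OF finA I n] obtain e
      where e: "e \<in> C" "e \<otimes>\<^bsub>A\<^esub> e = e" "\<forall>x\<in>C. e \<otimes>\<^bsub>A\<^esub> x = x" by blast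
    have ec: "e \<in> carrier A" using e by (intro C.a_Hcarr)
    have "x \<in> C" if "x \<in> \<Phi> e" for x
      using that e(1) C.I_r_closed[of e x] by (auto simp: \<Phi>_def)
    moreover have "x \<in> \<Phi> e" if "x \<in> C" for x
      using that e(3) C.a_Hcarr[OF that] by (simp add: \<Phi>_def)
    ultimately have "C = \<Phi> e" by blast
    moreover have "e \<in> ?E" using complementary_dual_iff_star_idempotent[OF I e] C e ec by blast
    ultimately show "C \<in> \<Phi> ` ?E" by blast
  qed
  ultimately show ?thesis using card_image[of \<Phi> ?E] by simp
qed

section \<open>Orbits under multiplication by \<open>m\<close> and -1, and the functions constant on
  them\<close>

definition block :: "'g \<Rightarrow> 'g set" where
  "block g = cyclotomic_class G m g \<union> cyclotomic_class G m (inv\<^bsub>G\<^esub> g)"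

lemma block_pow: "g \<in> carrier G \<Longrightarrow> block (g [^]\<^bsub>G\<^esub> m) = block g"
  using G.cyclotomic_class_pow[OF coprime_m, of g] G.cyclotomic_class_pow[OF coprime_m, of "inv\<^bsub>G\<^esub> g"]
  by (simp add: block_def G.nat_pow_inv)

lemma block_inv: "g \<in> carrier G \<Longrightarrow> block (inv\<^bsub>G\<^esub> g) = block g"
  by (auto simp: block_def)

lemma self_in_block: "g \<in> carrier G \<Longrightarrow> g \<in> block g"
  by (simp add: block_def G.cyclotomic_class_self)

definition fixed :: "('g \<Rightarrow> 'f) set" where
  "fixed = {u \<in> carrier A. u [^]\<^bsub>A\<^esub> m = u \<and> star u = u}"

lemma fixed_iff:
  "u \<in> fixed \<longleftrightarrow> u \<in> carrier A \<and> (\<forall>g\<in>carrier G. u (g [^]\<^bsub>G\<^esub> m) = u g \<and> u (inv\<^bsub>G\<^esub> g) = u g)"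
proof -
  have "star u = u \<longleftrightarrow> (\<forall>g\<in>carrier G. u (inv\<^bsub>G\<^esub> g) = u g)" if "u \<in> carrier A" for u
    using that by (metis star_apply star_closed eqI)
  then show ?thesis unfolding fixed_def using pow_m_eq_self_iff by blast
qed

lemma fixed_const_on_block:
  assumes u: "u \<in> fixed" and g: "g \<in> carrier G" and h: "h \<in> block g"
  shows "u h = u g"
proof -
  have pow: "u (g [^]\<^bsub>G\<^esub> (m ^ i)) = u g" if g: "g \<in> carrier G" for g i
  proof (induction i)
    case (Suc i)
    have "g [^]\<^bsub>G\<^esub> (m ^ Suc i) = (g [^]\<^bsub>G\<^esub> (m ^ i)) [^]\<^bsub>G\<^esub> m"
      using g by (simp add: G.nat_pow_pow mult.commute)
    then show ?case using u Suc g fixed_iff by simp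
  qed (use g in simp)
  show ?thesis
    using h pow[OF g] pow[of "inv\<^bsub>G\<^esub> g"] g u unfolding block_def cyclotomic_class_def fixed_iff by auto
qed

text \<open>These elements correspond to arbitrary functions from the set of blocks to
  \<open>F\<close>.\<close>

lemma card_fixed: "card fixed = m ^ card (block ` carrier G)"
proof -
  let ?P = "block ` carrier G"
  define \<Psi> where "\<Psi> w = (\<lambda>g\<in>carrier G. w (block g))" for w :: "'g set \<Rightarrow> 'f"
  have "bij_betw \<Psi> (?P \<rightarrow>\<^sub>E carrier F) fixed"
  proof (rule bij_betw_imageI)
    show "inj_on \<Psi> (?P \<rightarrow>\<^sub>E carrier F)"
    proof (rule inj_onI)
      fix v w assume v: "v \<in> ?P \<rightarrow>\<^sub>E carrier F" and w: "w \<in> ?P \<rightarrow>\<^sub>E carrier F" and eq: "\<Psi> v = \<Psi> w"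
      have "v (block g) = w (block g)" if "g \<in> carrier G" for g
        using fun_cong[OF eq, of g] that by (simp add: \<Psi>_def)
      then show "v = w" by (intro PiE_ext[OF v w]) blast
    qed
    show "\<Psi> ` (?P \<rightarrow>\<^sub>E carrier F) = fixed"
    proof (intro subset_antisym subsetI)
      fix u assume "u \<in> \<Psi> ` (?P \<rightarrow>\<^sub>E carrier F)"
      then obtain w where w: "w \<in> ?P \<rightarrow>\<^sub>E carrier F" and u: "u = \<Psi> w" by blast
      have "u \<in> carrier A" unfolding u \<Psi>_def using w by (intro restrict_closed) auto
      then show "u \<in> fixed" unfolding fixed_iff u \<Psi>_def by (simp add: block_pow block_inv)
    next
      fix u assume u: "u \<in> fixed"
      \<comment> \<open>The preimage of \<open>u\<close> takes on each block the value of
        \<open>u\<close> at a chosen representative.\<close>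
      define w where "w = (\<lambda>X\<in>?P. u (SOME g. g \<in> carrier G \<and> X = block g))"
      have w: "w (block g) = u g" if g: "g \<in> carrier G" for g
      proof -
        define h where "h = (SOME h. h \<in> carrier G \<and> block g = block h)"
        have "h \<in> carrier G \<and> block g = block h" unfolding h_def by (rule someI[of _ g]) (use g in simp)
        then have "h \<in> carrier G" "h \<in> block g" using self_in_block by auto
        then show ?thesis using fixed_const_on_block[OF u g, of h] g by (simp add: w_def h_def)
      qed
      have uc: "u \<in> carrier A" using u by (simp add: fixed_def)
      have "w \<in> ?P \<rightarrow>\<^sub>E carrier F"
        using w uc by (intro PiE_I) (auto simp: w_def)
      moreover have "u = \<Psi> w"
        using uc w by (intro eqI) (auto simp: \<Psi>_def intro!: restrict_closed)
      ultimately show "u \<in> \<Psi> ` (?P \<rightarrow>\<^sub>E carrier F)" by blast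
    qed
  qed
  then have "card fixed = card (?P \<rightarrow>\<^sub>E carrier F)" by (simp add: bij_betw_same_card)
  also have "\<dots> = m ^ card ?P" using finite_G order_F by (simp add: card_funcsetE order_def)
  finally show ?thesis .
qed

text \<open>Closure under products comes from multiplicativity of powers and of \<open>star\<close>;
  closure under sums and negatives from the pointwise description \<open>fixed_iff\<close>.\<close>

lemma subcring_fixed: "subcring fixed A"
proof (rule A.subcringI', rule A.subringI)
  show "fixed \<subseteq> carrier A" by (auto simp: fixed_def)
  have one: "\<one>\<^bsub>A\<^esub> \<in> fixed" by (simp add: fixed_def star_one)
  show "\<one>\<^bsub>A\<^esub> \<in> fixed" by fact
  fix u v assume u: "u \<in> fixed" and v: "v \<in> fixed"
  then have c: "u \<in> carrier A" "v \<in> carrier A" by (auto simp: fixed_def)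
  show "u \<otimes>\<^bsub>A\<^esub> v \<in> fixed"
    using u v by (auto simp: fixed_def star_mult A.nat_pow_distrib)
  show "u \<oplus>\<^bsub>A\<^esub> v \<in> fixed"
    using u v c unfolding fixed_iff by (simp add: add_apply)
next
  fix u assume u: "u \<in> fixed"
  then have c: "u \<in> carrier A" by (auto simp: fixed_def)
  have neg: "(\<ominus>\<^bsub>A\<^esub> u) g = \<ominus>\<^bsub>F\<^esub> u g" if "g \<in> carrier G" for g
  proof -
    have "(\<ominus>\<^bsub>A\<^esub> u) g \<oplus>\<^bsub>F\<^esub> u g = \<zero>\<^bsub>F\<^esub>"
      using c that by (simp add: A.l_neg zero_apply flip: add_apply)
    then show ?thesis using c that by (simp add: F.minus_equality)
  qed
  show "\<ominus>\<^bsub>A\<^esub> u \<in> fixed"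
    using u c unfolding fixed_iff by (simp add: neg)
qed

text \<open>All self-adjoint idempotents lie in \<open>fixed\<close>, a finite ring with
  \<open>x^m = x\<close>, so \<open>card_idempotents\<close> turns its cardinality into the number
  of idempotents.\<close>

theorem card_complementary_dual_codes:
  "card {C. abelian_code F G C \<and> euclidean_complementary_dual F G C} = 2 ^ card (block ` carrier G)"
proof -
  define B where "B = A\<lparr>carrier := fixed\<rparr>"
  interpret B: cring B
    unfolding B_def using subcring_fixed A.subcring_iff[OF subcringE(1)[OF subcring_fixed]] by simp
  have pow: "x [^]\<^bsub>B\<^esub> n = x [^]\<^bsub>A\<^esub> n" for x and n :: nat
    unfolding B_def by (rule A.nat_pow_consistent[symmetric])
  have "{\<zero>\<^bsub>F\<^esub>, \<one>\<^bsub>F\<^esub>} \<subseteq> carrier F" by simp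
  from card_mono[OF finite_F this] have m2: "m \<ge> 2" using order_F by (simp add: order_def)
  then obtain n where n: "m = Suc n" "n > 0" by (cases m) auto
  have sub: "x \<in> carrier A" if "x \<in> fixed" for x using that by (simp add: fixed_def)
  have finB: "finite (carrier B)"
    using finite_F finite_G finite_subset[OF subcringE(1)[OF subcring_fixed]]
    by (auto simp: B_def group_algebra_def intro: finite_PiE)
  have "card {f \<in> carrier B. f \<otimes>\<^bsub>B\<^esub> f = f} = 2 ^ card (block ` carrier G)"
  proof (rule B.card_idempotents[OF finB n(2)])
    show "card (carrier B) = Suc n ^ card (block ` carrier G)"
      using card_fixed by (simp add: B_def n)
    show "x [^]\<^bsub>B\<^esub> Suc n = x" if "x \<in> carrier B" for x
      using that unfolding pow n(1)[symmetric] by (simp add: B_def fixed_def)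
    fix e assume "e \<in> carrier B" and e2: "e \<otimes>\<^bsub>B\<^esub> e = e" and "e \<noteq> \<zero>\<^bsub>B\<^esub>"
    then have e: "e \<in> fixed" "e \<in> carrier A" "e \<otimes>\<^bsub>A\<^esub> e = e" "e \<noteq> \<zero>\<^bsub>A\<^esub>"
      using sub by (auto simp: B_def)
    then obtain g where g: "g \<in> carrier G" "e g \<noteq> \<zero>\<^bsub>F\<^esub>"
      using eqI[of e "\<zero>\<^bsub>A\<^esub>"] zero_apply by force
    \<comment> \<open>The scalar multiples \<open>c e\<close>, with \<open>c\<close> embedded as a
      constant. They lie in the corner of \<open>e\<close> and are distinct since \<open>e\<close>
      has a nonzero coefficient, so the corner has at least \<open>m\<close> elements.\<close>
    let ?\<phi> = "\<lambda>c. single \<one>\<^bsub>G\<^esub> c \<otimes>\<^bsub>A\<^esub> e"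
    have app: "?\<phi> c h = c \<otimes>\<^bsub>F\<^esub> e h" if "c \<in> carrier F" "h \<in> carrier G" for c h
      using that e by (simp add: single_mult_apply)
    have "inj_on ?\<phi> (carrier F)"
    proof (rule inj_onI)
      fix c d assume c: "c \<in> carrier F" and d: "d \<in> carrier F" and eq: "?\<phi> c = ?\<phi> d"
      have "c \<otimes>\<^bsub>F\<^esub> e g = d \<otimes>\<^bsub>F\<^esub> e g" using fun_cong[OF eq, of g] app c d g by simp
      then show "c = d" using c d g e by (simp add: F.m_rcancel)
    qed
    moreover have "?\<phi> ` carrier F \<subseteq> {x \<in> fixed. e \<otimes>\<^bsub>A\<^esub> x = x}"
    proof (intro image_subsetI CollectI conjI)
      fix c assume c: "c \<in> carrier F"
      show "?\<phi> c \<in> fixed" using c e(1,2) unfolding fixed_iff by (simp add: app)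
      show "e \<otimes>\<^bsub>A\<^esub> ?\<phi> c = ?\<phi> c"
        using c e A.m_lcomm[of e "single \<one>\<^bsub>G\<^esub> c" e] by simp
    qed
    moreover have "finite {x \<in> fixed. e \<otimes>\<^bsub>A\<^esub> x = x}" using finB by (simp add: B_def)
    ultimately have "card (carrier F) \<le> card {x \<in> fixed. e \<otimes>\<^bsub>A\<^esub> x = x}"
      by (rule card_inj_on_le)
    then show "Suc n \<le> card {x \<in> carrier B. e \<otimes>\<^bsub>B\<^esub> x = x}"
      using order_F n by (simp add: B_def order_def)
  qed
  moreover have "{f \<in> carrier B. f \<otimes>\<^bsub>B\<^esub> f = f} = {e \<in> carrier A. e \<otimes>\<^bsub>A\<^esub> e = e \<and> star e = e}"
  proof -
    have "e [^]\<^bsub>A\<^esub> m = e" if e: "e \<in> carrier A" "e \<otimes>\<^bsub>A\<^esub> e = e" for e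
    proof -
      have "e [^]\<^bsub>A\<^esub> Suc j = e" for j :: nat
        using e by (induction j) auto
      then show ?thesis using n by simp
    qed
    then show ?thesis by (auto simp: B_def fixed_def)
  qed
  ultimately show ?thesis using card_complementary_dual by simp
qed

text \<open>The map from a class \<open>X\<close> to the block \<open>X \<union> -X\<close> is the
  identity on type I classes and two-to-one on type II classes, and its images of the two types are
  disjoint.\<close>

lemma card_blocks:
  assumes "2 * r = card (type_II_classes G m)"
  shows "card (block ` carrier G) = card (type_I_classes G m) + r"
proof -
  let ?c = "cyclotomic_class G m"
  let ?h = "\<lambda>X. X \<union> m_inv G ` X"
  let ?I = "type_I_classes G m" and ?II = "type_II_classes G m"
  have h: "?h (?c a) = block a" if "a \<in> carrier G" for a
    using that by (simp add: G.inv_image_cyclotomic_class block_def)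
  have I: "X \<in> ?I \<longleftrightarrow> (\<exists>a\<in>carrier G. X = ?c a) \<and> m_inv G ` X = X" for X
    unfolding type_I_classes_def using G.inv_image_cyclotomic_class by fastforce
  have II: "X \<in> ?II \<longleftrightarrow> (\<exists>a\<in>carrier G. X = ?c a) \<and> m_inv G ` X \<noteq> X" for X
    unfolding type_II_classes_def using G.inv_image_cyclotomic_class by fastforce
  have fin: "finite ?I" "finite ?II"
    using finite_G by (auto simp: type_I_classes_def type_II_classes_def)
  have inv_inv: "m_inv G ` m_inv G ` X = X" if "\<exists>a\<in>carrier G. X = ?c a" for X
  proof -
    from that obtain a where "a \<in> carrier G" "X = ?c a" by blast
    then show ?thesis by (simp add: G.inv_image_cyclotomic_class)
  qed
  \<comment> \<open>A block determines its class up to negation: a representative of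
    \<open>Y\<close> lies in \<open>X\<close> or in \<open>-X\<close>, and classes that meet
    coincide.\<close>
  have h_eq: "Y = X \<or> Y = m_inv G ` X"
    if X: "\<exists>a\<in>carrier G. X = ?c a" and Y: "\<exists>a\<in>carrier G. Y = ?c a" and eq: "?h X = ?h Y" for X Y
  proof -
    obtain a b where a: "a \<in> carrier G" "X = ?c a" and b: "b \<in> carrier G" "Y = ?c b" using X Y by blast
    have "b \<in> ?h X" unfolding eq using b G.cyclotomic_class_self by simp
    then have "b \<in> ?c a \<or> b \<in> ?c (inv\<^bsub>G\<^esub> a)" using a G.inv_image_cyclotomic_class by simp
    then have "?c b = ?c a \<or> ?c b = ?c (inv\<^bsub>G\<^esub> a)"
      using G.cyclotomic_class_eq[OF coprime_m] a(1) G.inv_closed by blast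
    then show ?thesis using a b G.inv_image_cyclotomic_class by simp
  qed
  have "block ` carrier G = ?h ` ?I \<union> ?h ` ?II"
  proof (intro subset_antisym subsetI)
    fix X assume "X \<in> block ` carrier G"
    then obtain a where a: "a \<in> carrier G" "X = ?h (?c a)" using h by auto
    then have "?c a \<in> ?I \<union> ?II" using I II by blast
    then show "X \<in> ?h ` ?I \<union> ?h ` ?II" using a by blast
  next
    fix X assume "X \<in> ?h ` ?I \<union> ?h ` ?II"
    then obtain Y where Y: "Y \<in> ?I \<union> ?II" "X = ?h Y" by blast
    then obtain a where a: "a \<in> carrier G" "Y = ?c a" using I[of Y] II[of Y] by blast
    show "X \<in> block ` carrier G" using h[OF a(1)] a Y(2) by simp
  qed
  moreover have "?h ` ?I \<inter> ?h ` ?II = {}"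
  proof -
    have False if X: "X \<in> ?I" and Y: "Y \<in> ?II" and eq: "?h X = ?h Y" for X Y
    proof -
      have "Y = X" using h_eq[OF _ _ eq] X Y I[of X] II[of Y] by metis
      then show False using X Y I[of X] II[of X] by simp
    qed
    then show ?thesis by (intro equals0I) (elim IntE imageE, simp)
  qed
  ultimately have "card (block ` carrier G) = card (?h ` ?I) + card (?h ` ?II)"
    using fin by (simp add: card_Un_disjoint)
  moreover have "?h ` ?I = ?I" using I by (auto simp: image_iff)
  moreover have "2 * card (?h ` ?II) = card ?II"
  proof -
    \<comment> \<open>Count the type II classes by fibres of \<open>?h\<close>; each fibre is a pair
      \<open>X\<close>, \<open>-X\<close> of distinct classes.\<close>
    have "card ?II = (\<Sum>Z\<in>?h ` ?II. card {X \<in> ?II. ?h X = Z})"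
      using sum.image_gen[OF fin(2), of "\<lambda>_. 1::nat" ?h] by simp
    also have "\<dots> = (\<Sum>Z\<in>?h ` ?II. 2)"
    proof (rule sum.cong[OF refl])
      fix Z assume "Z \<in> ?h ` ?II"
      then obtain X where X: "X \<in> ?II" "Z = ?h X" by blast
      obtain a where a: "a \<in> carrier G" "X = ?c a" using X II[of X] by blast
      have inv: "m_inv G ` X \<in> ?II"
      proof -
        have "m_inv G ` X = ?c (inv\<^bsub>G\<^esub> a)" using a G.inv_image_cyclotomic_class by simp
        then show ?thesis using X a inv_inv[of X] II[of X] II[of "m_inv G ` X"] G.inv_closed by metis
      qed
      have "{Y \<in> ?II. ?h Y = Z} = {X, m_inv G ` X}"
      proof (intro subset_antisym subsetI)
        fix Y assume "Y \<in> {Y \<in> ?II. ?h Y = Z}"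
        then show "Y \<in> {X, m_inv G ` X}" using h_eq[of X Y] X II[of X] II[of Y] by blast
      next
        fix Y assume "Y \<in> {X, m_inv G ` X}"
        then show "Y \<in> {Y \<in> ?II. ?h Y = Z}" using X inv inv_inv[of X] a by auto
      qed
      then show "card {Y \<in> ?II. ?h Y = Z} = 2" using X II[of X] card_2_iff[of "{X, m_inv G ` X}"] by metis
    qed
    finally show ?thesis by simp
  qed
  ultimately show ?thesis using assms by simp
qed

end

section \<open>Powers of a prime and homocyclic groups\<close>

text \<open>The order of \<open>m\<close> modulo \<open>q ^ k\<close> is a multiple of the order
  modulo \<open>q\<close>, hence \<open>2t\<close>, and \<open>q ^ k\<close> divides
  \<open>(m^t - 1)(m^t + 1)\<close>. The factors differ by 2, so the odd prime \<open>q\<close>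
  divides only one of them, which then absorbs all of \<open>q ^ k\<close>. Minimality of the order
  rules out the first.\<close>

lemma neg_one_power_mod_prime_power:
  assumes q: "prime (q::nat)" "odd q" and m: "coprime q m" and ev: "even (ord q m)"
  shows "\<exists>j. q ^ k dvd m ^ j + 1"
proof (cases "k = 0")
  case False
  define n where "n = ord (q ^ k) m"
  have "coprime (q ^ k) m" using m by simp
  then have n0: "n > 0" by (simp add: n_def)
  have n: "[m ^ n = 1] (mod q ^ k)" unfolding n_def by (rule ord)
  then have "[m ^ n = 1] (mod q)"
    by (rule cong_dvd_modulus_nat) (use False in simp)
  then have "even n" using ev ord_divides by (metis dvd_trans)
  then obtain t where t: "n = 2 * t" by blast
  have "int (q ^ k) dvd int m ^ n - 1"
    using n by (metis cong_iff_dvd_diff cong_int_iff of_nat_1 of_nat_power)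
  also have "int m ^ n - 1 = (int m ^ t - 1) * (int m ^ t + 1)"
    by (simp add: t power_mult power_mult_distrib algebra_simps power2_eq_square power_even_eq)
  finally have d: "int (q ^ k) dvd (int m ^ t - 1) * (int m ^ t + 1)" .
  have pq: "prime (int q)" using q by simp
  show ?thesis
  proof (cases "int q dvd int m ^ t - 1")
    case True
    have "\<not> int q dvd int m ^ t + 1"
    proof
      assume "int q dvd int m ^ t + 1"
      then have "int q dvd (int m ^ t + 1) - (int m ^ t - 1)" using True by (rule dvd_diff)
      then have "q dvd 2" by (simp add: int_dvd_int_iff[symmetric])
      then show False using q by (metis primes_dvd_imp_eq two_is_prime_nat even_numeral)
    qed
    then have "coprime (int q ^ k) (int m ^ t + 1)"
      using pq by (intro coprime_power_left_iff[THEN iffD2] disjI1 prime_imp_coprime)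
    then have "int (q ^ k) dvd int m ^ t - 1"
      using d by (simp add: coprime_dvd_mult_left_iff)
    then have "[m ^ t = 1] (mod q ^ k)"
      by (metis cong_iff_dvd_diff cong_int_iff of_nat_1 of_nat_power)
    then have "n dvd t" unfolding n_def by (simp only: ord_divides)
    then show ?thesis using n0 t by (auto dest: dvd_imp_le)
  next
    case False
    then have "coprime (int q ^ k) (int m ^ t - 1)"
      using pq by (intro coprime_power_left_iff[THEN iffD2] disjI1 prime_imp_coprime)
    then have "int (q ^ k) dvd int m ^ t + 1"
      using d by (simp add: coprime_dvd_mult_right_iff)
    then have "q ^ k dvd m ^ t + 1"
      by (metis int_dvd_int_iff of_nat_1 of_nat_add of_nat_power)
    then show ?thesis by blast
  qed
qed simp

text \<open>If \<open>m^j\<close> were -1 modulo \<open>q\<close>, the order would divide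
  \<open>2j\<close>, hence \<open>j\<close> as it is odd. Then 1 and -1 would agree modulo the odd
  prime \<open>q\<close>.\<close>

lemma neg_one_not_power_mod_prime:
  assumes q: "prime (q::nat)" "odd q" and od: "odd (ord q m)"
  shows "\<not> q dvd m ^ j + 1"
proof
  assume d: "q dvd m ^ j + 1"
  have "[m ^ (2 * j) = 1] (mod q)"
  proof -
    have "int q dvd (int m ^ j + 1) * (int m ^ j - 1)"
      using d by (metis dvd_mult2 int_dvd_int_iff of_nat_1 of_nat_add of_nat_power)
    also have "(int m ^ j + 1) * (int m ^ j - 1) = int (m ^ (2 * j)) - int 1"
      by (simp add: power_mult power2_eq_square algebra_simps power_even_eq)
    finally show ?thesis by (metis cong_iff_dvd_diff cong_int_iff)
  qed
  then have "ord q m dvd 2 * j" by (simp only: ord_divides)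
  then have "ord q m dvd j" using od by (simp add: coprime_dvd_mult_right_iff)
  then have "[m ^ j = 1] (mod q)" by (simp only: ord_divides)
  then have "[m ^ j + 1 = 1 + 1] (mod q)" by (rule cong_add) simp
  then have "q dvd 2" using d cong_dvd_iff[of "m ^ j + 1" 2 q] by (simp add: numeral_2_eq_2)
  then show False using q by (metis primes_dvd_imp_eq two_is_prime_nat even_numeral)
qed

section \<open>Homocyclic groups and their torsion\<close>

lemma carrier_homocyclic:
  "n > 0 \<Longrightarrow> carrier (homocyclic_group n s) = {..<s} \<rightarrow>\<^sub>E {0..<int n}"
  by (simp add: homocyclic_group_def carrier_integer_mod_group)

lemma comm_group_homocyclic: "comm_group (homocyclic_group n s)"
proof (rule group.group_comm_groupI)
  show "group (homocyclic_group n s)" by (simp add: homocyclic_group_def)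
qed (auto simp: homocyclic_group_def add.commute)

lemma order_homocyclic: "n > 0 \<Longrightarrow> order (homocyclic_group n s) = n ^ s"
  by (simp add: order_def carrier_homocyclic card_funcsetE)

lemma pow_homocyclic:
  assumes "a \<in> carrier (homocyclic_group n s)"
  shows "a [^]\<^bsub>homocyclic_group n s\<^esub> (t::nat) = (\<lambda>i\<in>{..<s}. (int t * a i) mod int n)"
proof (induction t)
  case (Suc t)
  then show ?case
    by (auto simp: homocyclic_group_def mod_simps distrib_right add.commute intro!: restrict_ext)
qed (auto simp: homocyclic_group_def)

lemma card_multiples_below:
  assumes "d > 0"
  shows "card {x \<in> {0..<int (d * e)}. int d dvd x} = e"
proof -
  have "{x \<in> {0..<int (d * e)}. int d dvd x} = (\<lambda>y. int d * y) ` {0..<int e}"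
    using assms by (auto simp: dvd_def zero_le_mult_iff)
  then show ?thesis using assms by (simp add: card_image inj_on_def)
qed

text \<open>An element is killed by \<open>q ^ i\<close> iff each coordinate is a multiple of
  \<open>q ^ (k - i)\<close>, which leaves \<open>q ^ i\<close> choices per coordinate.\<close>

lemma card_torsion_homocyclic:
  assumes q: "q > 0" and i: "i \<le> k"
  shows "card {a \<in> carrier (homocyclic_group (q ^ k) s).
      a [^]\<^bsub>homocyclic_group (q ^ k) s\<^esub> (q ^ i) = \<one>\<^bsub>homocyclic_group (q ^ k) s\<^esub>} = q ^ (i * s)"
proof -
  let ?A = "homocyclic_group (q ^ k) s"
  have k: "q ^ k = q ^ (k - i) * q ^ i" using i by (simp flip: power_add)
  have dvd: "(int (q ^ i) * x) mod int (q ^ k) = 0 \<longleftrightarrow> int (q ^ (k - i)) dvd x" for x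
    using q unfolding k mod_eq_0_iff_dvd of_nat_mult mult.commute[of "int (q ^ (k - i))"] by simp
  have "a [^]\<^bsub>?A\<^esub> (q ^ i) = \<one>\<^bsub>?A\<^esub> \<longleftrightarrow> (\<forall>j<s. int (q ^ (k - i)) dvd a j)"
    if "a \<in> carrier ?A" for a
  proof -
    have "a [^]\<^bsub>?A\<^esub> (q ^ i) = \<one>\<^bsub>?A\<^esub> \<longleftrightarrow> (\<forall>j<s. (int (q ^ i) * a j) mod int (q ^ k) = 0)"
      unfolding pow_homocyclic[OF that]
      by (auto simp: homocyclic_group_def restrict_def fun_eq_iff)
    then show ?thesis unfolding dvd .
  qed
  then have "{a \<in> carrier ?A. a [^]\<^bsub>?A\<^esub> (q ^ i) = \<one>\<^bsub>?A\<^esub>}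
      = {a \<in> carrier ?A. \<forall>j<s. int (q ^ (k - i)) dvd a j}" by blast
  also have "\<dots> = {..<s} \<rightarrow>\<^sub>E {x \<in> {0..<int (q ^ k)}. int (q ^ (k - i)) dvd x}"
  proof -
    have "{a \<in> S \<rightarrow>\<^sub>E T. \<forall>j\<in>S. P (a j)} = S \<rightarrow>\<^sub>E {x \<in> T. P x}" for S :: "nat set" and T and P :: "int \<Rightarrow> bool"
      unfolding set_eq_iff mem_Collect_eq PiE_iff by blast
    from this[of "{..<s}"] show ?thesis using q by (simp add: carrier_homocyclic Ball_def)
  qed
  finally have "{a \<in> carrier ?A. a [^]\<^bsub>?A\<^esub> (q ^ i) = \<one>\<^bsub>?A\<^esub>}
      = {..<s} \<rightarrow>\<^sub>E {x \<in> {0..<int (q ^ k)}. int (q ^ (k - i)) dvd x}" .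
  then show ?thesis
    using card_multiples_below[of "q ^ (k - i)" "q ^ i"] q
    by (simp add: card_funcsetE power_mult flip: k)
qed

text \<open>The formulas are equations of real numbers, so the quotients are exact rather than
  truncated.\<close>

theorem mainTheorem12:
  fixes p q \<nu> k s r\<^sub>I r\<^sub>I\<^sub>I :: nat
    and F :: "('f, 'm) ring_scheme"
    and A :: "(nat \<Rightarrow> int) monoid"
  assumes "prime p" and "prime q" and "odd q" and "coprime p q"
    and "\<nu> > 0" and "k > 0" and "s > 0"
    and "field F" and "order F = p ^ \<nu>"
    and "A = homocyclic_group (q ^ k) s"
    and "r\<^sub>I = card (type_I_classes A (p ^ \<nu>))"
    and "2 * r\<^sub>I\<^sub>I = card (type_II_classes A (p ^ \<nu>))"
  shows "(even (ord q (p ^ \<nu>)) \<longrightarrow>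
           real r\<^sub>I = 1 + (\<Sum>i=1..k. (real q ^ (i * s) - real q ^ ((i - 1) * s))
                                    / real (ord (q ^ i) (p ^ \<nu>)))
           \<and> r\<^sub>I\<^sub>I = 0)
       \<and> (odd (ord q (p ^ \<nu>)) \<longrightarrow>
           r\<^sub>I = 1
           \<and> real r\<^sub>I\<^sub>I = (\<Sum>i=1..k. (real q ^ (i * s) - real q ^ ((i - 1) * s))
                                  / (2 * real (ord (q ^ i) (p ^ \<nu>)))))
       \<and> card {C. abelian_code F A C \<and> euclidean_complementary_dual F A C} = 2 ^ (r\<^sub>I + r\<^sub>I\<^sub>I)"
proof -
  define m where "m = p ^ \<nu>"
  have q0: "q > 0" using \<open>prime q\<close> prime_gt_0_nat by blast
  have oA: "order A = q ^ (k * s)" using q0 assms(10) by (simp add: order_homocyclic power_mult)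
  interpret G: comm_group A using assms(10) by (simp add: comm_group_homocyclic)
  interpret code: coprime_group_algebra F A p \<nu>
    using \<open>field F\<close> G.comm_group_axioms
    by (rule coprime_group_algebra.intro, unfold_locales) (use assms(1,4,9) oA in auto)
  have qm: "coprime q m" using assms(4) by (simp add: m_def coprime_commute)
  have mA: "coprime m (order A)" using code.coprime_m by (simp add: m_def)
  have fin: "finite (carrier A)" by (rule code.finite_G)
  let ?c = "cyclotomic_class A m"
  let ?I = "type_I_classes A m" and ?II = "type_II_classes A m"
  have tors: "card {a \<in> carrier A. a [^]\<^bsub>A\<^esub> (q ^ i) = \<one>\<^bsub>A\<^esub>} = q ^ (i * s)" if "i \<le> k" for i
    using card_torsion_homocyclic[OF q0 that] assms(10) by simp
  \<comment> \<open>The torsion count at \<open>i = k\<close> already equals the order of the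
    group.\<close>
  have exponent: "a [^]\<^bsub>A\<^esub> (q ^ k) = \<one>\<^bsub>A\<^esub>" if a: "a \<in> carrier A" for a
  proof -
    have "card {a \<in> carrier A. a [^]\<^bsub>A\<^esub> (q ^ k) = \<one>\<^bsub>A\<^esub>} = card (carrier A)"
      using tors[of k] oA by (simp add: order_def)
    then have "{a \<in> carrier A. a [^]\<^bsub>A\<^esub> (q ^ k) = \<one>\<^bsub>A\<^esub>} = carrier A"
      by (intro card_subset_eq fin) auto
    then show ?thesis using a by blast
  qed
  \<comment> \<open>The leading 1 is the class of the identity, as
    \<open>ord 1 m = 1\<close>.\<close>
  have total: "real (card (?c ` carrier A))
      = 1 + (\<Sum>i=1..k. (real q ^ (i * s) - real q ^ ((i - 1) * s)) / real (ord (q ^ i) m))"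
    using G.sum_by_order_prime_power[OF \<open>prime q\<close> fin tors exponent, of "\<lambda>d. 1 / real (ord d m)"]
    by (simp add: G.card_cyclotomic_classes[OF fin mA])
  have ord_a: "G.ord a dvd q ^ k" if "a \<in> carrier A" for a
    using exponent[OF that] G.pow_eq_id[OF that] by blast
  have inv_iff: "?c a = ?c (inv\<^bsub>A\<^esub> a) \<longleftrightarrow> (\<exists>j. G.ord a dvd m ^ j + 1)" if a: "a \<in> carrier A" for a
    using G.inv_mem_cyclotomic_class_iff[OF a] G.cyclotomic_class_eq[OF mA a]
      G.cyclotomic_class_self[OF G.inv_closed[OF a]] by metis
  have even_case: "real r\<^sub>I = real (card (?c ` carrier A)) \<and> r\<^sub>I\<^sub>I = 0" if ev: "even (ord q m)"
  proof -
    \<comment> \<open>All element orders divide \<open>q ^ k\<close>, so this one exponent makes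
      every class type I.\<close>
    obtain j where "q ^ k dvd m ^ j + 1"
      using neg_one_power_mod_prime_power[OF \<open>prime q\<close> \<open>odd q\<close> qm ev] by blast
    then have "?c a = ?c (inv\<^bsub>A\<^esub> a)" if "a \<in> carrier A" for a
      using inv_iff[OF that] ord_a[OF that] dvd_trans by blast
    then have II: "?II = {}" unfolding type_II_classes_def by blast
    then have "?I = ?c ` carrier A" using G.type_I_Un_type_II[of m] by simp
    then show ?thesis using II assms(11,12) by (simp add: m_def)
  qed
  have odd_case: "r\<^sub>I = 1 \<and> real (card (?c ` carrier A)) = 1 + 2 * real r\<^sub>I\<^sub>I" if "odd (ord q m)"
  proof -
    \<comment> \<open>Any other element has order divisible by \<open>q\<close>, while -1 is no
      power of \<open>m\<close> modulo \<open>q\<close>.\<close>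
    have one: "a = \<one>\<^bsub>A\<^esub>" if a: "a \<in> carrier A" and eq: "?c a = ?c (inv\<^bsub>A\<^esub> a)" for a
    proof -
      obtain j where j: "G.ord a dvd m ^ j + 1" using inv_iff[OF a] eq by blast
      obtain i where i: "G.ord a = q ^ i"
        using ord_a[OF a] divides_primepow_nat[OF \<open>prime q\<close>] by blast
      have "i = 0"
      proof (rule ccontr)
        assume "i \<noteq> 0"
        then have "q dvd G.ord a" unfolding i by (simp add: dvd_power)
        then have "q dvd m ^ j + 1" using j by (rule dvd_trans)
        then show False
          using neg_one_not_power_mod_prime[OF \<open>prime q\<close> \<open>odd q\<close> \<open>odd (ord q m)\<close>] by blast
      qed
      then show ?thesis using i G.ord_eq_1[OF a] by simp
    qed
    have I: "?I = {?c \<one>\<^bsub>A\<^esub>}"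
      unfolding type_I_classes_def using one by fastforce
    then have "r\<^sub>I = 1" using assms(11) by (simp add: m_def)
    \<comment> \<open>Both types are defined through representatives, so disjointness rests on the
      class of the identity having no other representative.\<close>
    moreover have "?I \<inter> ?II = {}"
    proof -
      have "a = \<one>\<^bsub>A\<^esub>" if "a \<in> carrier A" "?c a = ?c \<one>\<^bsub>A\<^esub>" for a
        using that G.cyclotomic_class_self[of a m] by (auto simp: cyclotomic_class_def)
      then show ?thesis unfolding I type_II_classes_def by fastforce
    qed
    moreover have "finite ?I" "finite ?II"
      using fin by (auto simp: type_I_classes_def type_II_classes_def)
    ultimately have "card (?c ` carrier A) = r\<^sub>I + 2 * r\<^sub>I\<^sub>I"
      using assms(11,12) by (simp add: card_Un_disjoint m_def flip: G.type_I_Un_type_II)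
    then show ?thesis using \<open>r\<^sub>I = 1\<close> by simp
  qed
  have "card {C. abelian_code F A C \<and> euclidean_complementary_dual F A C} = 2 ^ (r\<^sub>I + r\<^sub>I\<^sub>I)"
    using code.card_complementary_dual_codes code.card_blocks[OF assms(12)] assms(11) by simp
  moreover have "real r\<^sub>I\<^sub>I = (\<Sum>i=1..k. (real q ^ (i * s) - real q ^ ((i - 1) * s)) / (2 * real (ord (q ^ i) m)))"
    if "odd (ord q m)"
  proof -
    have "(\<Sum>i=1..k. (real q ^ (i * s) - real q ^ ((i - 1) * s)) / (2 * real (ord (q ^ i) m)))
      = (\<Sum>i=1..k. (real q ^ (i * s) - real q ^ ((i - 1) * s)) / real (ord (q ^ i) m)) / 2"
      by (simp add: sum_divide_distrib mult.commute)
    then show ?thesis using odd_case[OF that] total by simp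
  qed
  ultimately show ?thesis using even_case odd_case total unfolding m_def by auto
qed

end
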